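(* Let $(X,\|\cdot\|)$ be a Banach space and let $\tau$ be a locally convex topology on $X$, coarser than the norm topology, such that (a) $(X,\tau)$ is sequentially complete on norm bounded sets, and (b) $(X,\tau)'$ is norming for $(X,\|\cdot\|)$. Let $\gamma:=\gamma(\|\cdot\|,\tau)$ be the mixed topology and suppose that $\gamma^+=\gamma$. Let $\{T(t)\}_{t\ge0}$ be a semigroup of linear operators on $X$. Then $\{T(t)\}_{t\ge0}$ is bi-continuous for $\tau$ if and only if it is a SCLE semigroup for $\gamma$.
   Context: Sequentially complete on norm bounded sets: every norm bounded $\tau$-Cauchy sequence is $\tau$-convergent in $X$. Norming: $\|x\|=\sup_{x'\in B_\tau}|\langle x,x'\rangle|$ for all $x\in X$, where $B_\tau$ is the set of $x'\in(X,\tau)'$ with operator norm (with respect to $\|\cdot\|$) at most $1$. The mixed topology $\gamma(\|\cdot\|,\tau)$ is the strongest locally convex topology on $X$ that coincides with $\tau$ on norm bounded sets. For a locally convex topology $\gamma$, $\gamma^+$ denotes the strongest locally convex topology having the same convergent sequences as $\gamma$. A semigroup is a family of linear operators with $T(0)=\mathrm{Id}$, $T(t)T(s)=T(t+s)$ for $s,t\ge0$. It is bi-continuous for $\tau$ if the $T(t)$ are norm continuous and: (1) $t\mapsto T(t)x$ is $\tau$-continuous on $[0,\infty)$ for every $x\in X$; (2) it is locally bi-continuous: for every $t_0\ge0$ and every norm bounded sequence $(x_n)$ converging to $x\in X$ for $\tau$, one has $\tau\text{-}\lim_{n\to\infty}T(t)(x_n-x)=0$ uniformly for $t\le t_0$;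 (3) there exist $M\ge1$, $\omega\in\mathbb R$ with $\|T(t)\|\le Me^{\omega t}$ for all $t\ge0$. It is SCLE for $\gamma$ if the $T(t)$ are $\gamma$-continuous, $t\mapsto T(t)x$ is $\gamma$-continuous for every $x$, and for every $t\ge0$ and $\gamma$-continuous semi-norm $p$ there is a $\gamma$-continuous semi-norm $q$ with $\sup_{s\le t}p(T(s)x)\le q(x)$ for all $x\in X$. *)

theory Defs
  imports "HOL-Analysis.Analysis"
begin

section \<open>Scalars\<close>

text \<open>
  The scalar field may be the reals or the complex numbers: up to isomorphism these are the only
  instances of class \<open>real_normed_field\<close> (Gelfand--Mazur).  Class \<open>banach\<close> only knows about real
  scalars, so the multiplication by scalars from \<open>'k\<close> is an explicit parameter \<open>s\<close>.  Real Banach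
  spaces are the case \<open>s = scaleR\<close>.  Note that convexity, boundedness and completeness depend on the
  real structure only.
\<close>

definition normed_space_over :: "('k::real_normed_field \<Rightarrow> 'a::real_normed_vector \<Rightarrow> 'a) \<Rightarrow> bool" where
  "normed_space_over s \<longleftrightarrow>
     vector_space s \<and>
     (\<forall>r x. s (of_real r) x = r *\<^sub>R x) \<and>
     (\<forall>c x. norm (s c x) = norm c * norm x)"

section \<open>Locally convex topologies\<close>

text \<open>Locally convex topologies are not required to be Hausdorff.\<close>

definition locally_convex_topology ::
    "('k::real_normed_field \<Rightarrow> 'a::real_normed_vector \<Rightarrow> 'a) \<Rightarrow> 'a topology \<Rightarrow> bool" where
  "locally_convex_topology s \<tau> \<longleftrightarrow>
     topspace \<tau> = UNIV \<and>
     continuous_map (prod_topology \<tau> \<tau>) \<tau> (\<lambda>(x, y). x + y) \<and>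
     continuous_map (prod_topology euclidean \<tau>) \<tau> (\<lambda>(c, x). s c x) \<and>
     (\<forall>U. openin \<tau> U \<and> 0 \<in> U \<longrightarrow> (\<exists>V. openin \<tau> V \<and> 0 \<in> V \<and> V \<subseteq> U \<and> convex V))"

definition seminorm :: "('k::real_normed_field \<Rightarrow> 'a::real_normed_vector \<Rightarrow> 'a) \<Rightarrow> ('a \<Rightarrow> real) \<Rightarrow> bool" where
  "seminorm s p \<longleftrightarrow>
     (\<forall>x. 0 \<le> p x) \<and> (\<forall>x y. p (x + y) \<le> p x + p y) \<and> (\<forall>c x. p (s c x) = norm c * p x)"

definition continuous_seminorm ::
    "('k::real_normed_field \<Rightarrow> 'a::real_normed_vector \<Rightarrow> 'a) \<Rightarrow> 'a topology \<Rightarrow> ('a \<Rightarrow> real) \<Rightarrow> bool" where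
  "continuous_seminorm s \<tau> p \<longleftrightarrow> seminorm s p \<and> continuous_map \<tau> euclideanreal p"

definition coarser_topology :: "'a topology \<Rightarrow> 'a topology \<Rightarrow> bool" where
  "coarser_topology \<sigma> \<tau> \<longleftrightarrow> (\<forall>U. openin \<sigma> U \<longrightarrow> openin \<tau> U)"

definition is_strongest_topology :: "('a topology \<Rightarrow> bool) \<Rightarrow> 'a topology \<Rightarrow> bool" where
  "is_strongest_topology P \<sigma> \<longleftrightarrow> P \<sigma> \<and> (\<forall>\<sigma>'. P \<sigma>' \<longrightarrow> coarser_topology \<sigma>' \<sigma>)"

definition strongest_topology :: "('a topology \<Rightarrow> bool) \<Rightarrow> 'a topology" where
  "strongest_topology P = (THE \<sigma>. is_strongest_topology P \<sigma>)"

text \<open>Existence of the two topologies below is shown at the end of this theory.\<close>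

definition mixed_topology ::
    "('k::real_normed_field \<Rightarrow> 'a::real_normed_vector \<Rightarrow> 'a) \<Rightarrow> 'a topology \<Rightarrow> 'a topology" where
  "mixed_topology s \<tau> = strongest_topology
     (\<lambda>\<sigma>. locally_convex_topology s \<sigma> \<and> (\<forall>B. bounded B \<longrightarrow> subtopology \<sigma> B = subtopology \<tau> B))"

definition plus_topology ::
    "('k::real_normed_field \<Rightarrow> 'a::real_normed_vector \<Rightarrow> 'a) \<Rightarrow> 'a topology \<Rightarrow> 'a topology" where
  "plus_topology s \<gamma> = strongest_topology
     (\<lambda>\<sigma>. locally_convex_topology s \<sigma> \<and>
          (\<forall>(x :: nat \<Rightarrow> 'a) l. limitin \<sigma> x l sequentially \<longleftrightarrow> limitin \<gamma> x l sequentially))"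

section \<open>Compatibility of the norm with the locally convex topology\<close>

definition Cauchy_in_topology :: "'a::real_normed_vector topology \<Rightarrow> (nat \<Rightarrow> 'a) \<Rightarrow> bool" where
  "Cauchy_in_topology \<tau> x \<longleftrightarrow>
     (\<forall>U. openin \<tau> U \<and> 0 \<in> U \<longrightarrow> (\<exists>N. \<forall>m\<ge>N. \<forall>n\<ge>N. x m - x n \<in> U))"

definition seq_complete_on_bounded :: "'a::real_normed_vector topology \<Rightarrow> bool" where
  "seq_complete_on_bounded \<tau> \<longleftrightarrow>
     (\<forall>x. bounded (range x) \<and> Cauchy_in_topology \<tau> x \<longrightarrow> (\<exists>l. limitin \<tau> x l sequentially))"

definition continuous_dual ::
    "('k::real_normed_field \<Rightarrow> 'a::real_normed_vector \<Rightarrow> 'a) \<Rightarrow> 'a topology \<Rightarrow> ('a \<Rightarrow> 'k) set" where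
  "continuous_dual s \<tau> = {f. Vector_Spaces.linear s (*) f \<and> continuous_map \<tau> euclidean f}"

text \<open>\<open>onorm\<close> is the operator norm only for bounded linear maps, hence the extra condition.\<close>

definition dual_unit_ball ::
    "('k::real_normed_field \<Rightarrow> 'a::real_normed_vector \<Rightarrow> 'a) \<Rightarrow> 'a topology \<Rightarrow> ('a \<Rightarrow> 'k) set" where
  "dual_unit_ball s \<tau> = {f \<in> continuous_dual s \<tau>. bounded_linear f \<and> onorm f \<le> 1}"

text \<open>The supremum is over a nonempty set of reals bounded above by \<open>norm x\<close>.\<close>

definition norming_dual ::
    "('k::real_normed_field \<Rightarrow> 'a::real_normed_vector \<Rightarrow> 'a) \<Rightarrow> 'a topology \<Rightarrow> bool" where
  "norming_dual s \<tau> \<longleftrightarrow> (\<forall>x. norm x = (SUP f\<in>dual_unit_ball s \<tau>. norm (f x)))"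

section \<open>Semigroups\<close>

text \<open>A semigroup is a function on all reals; its values at negative times are irrelevant.\<close>

definition operator_semigroup ::
    "('k::real_normed_field \<Rightarrow> 'a::real_normed_vector \<Rightarrow> 'a) \<Rightarrow> (real \<Rightarrow> 'a \<Rightarrow> 'a) \<Rightarrow> bool" where
  "operator_semigroup s T \<longleftrightarrow>
     (\<forall>t\<ge>0. Vector_Spaces.linear s s (T t)) \<and>
     T 0 = id \<and>
     (\<forall>t\<ge>0. \<forall>u\<ge>0. T t \<circ> T u = T (t + u))"

definition bicontinuous_semigroup ::
    "('k::real_normed_field \<Rightarrow> 'a::real_normed_vector \<Rightarrow> 'a) \<Rightarrow> 'a topology \<Rightarrow> (real \<Rightarrow> 'a \<Rightarrow> 'a) \<Rightarrow> bool" where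
  "bicontinuous_semigroup s \<tau> T \<longleftrightarrow>
     operator_semigroup s T \<and>
     (\<forall>t\<ge>0. continuous_on UNIV (T t)) \<and>
     (\<forall>x. continuous_map (top_of_set {0..}) \<tau> (\<lambda>t. T t x)) \<and>
     (\<forall>t0\<ge>0. \<forall>x l. bounded (range x) \<and> limitin \<tau> x l sequentially \<longrightarrow>
        (\<forall>U. openin \<tau> U \<and> 0 \<in> U \<longrightarrow> (\<exists>N. \<forall>n\<ge>N. \<forall>t\<in>{0..t0}. T t (x n - l) \<in> U))) \<and>
     (\<exists>M \<omega>. M \<ge> 1 \<and> (\<forall>t\<ge>0. onorm (T t) \<le> M * exp (\<omega> * t)))"

definition SCLE_semigroup ::
    "('k::real_normed_field \<Rightarrow> 'a::real_normed_vector \<Rightarrow> 'a) \<Rightarrow> 'a topology \<Rightarrow> (real \<Rightarrow> 'a \<Rightarrow> 'a) \<Rightarrow> bool" where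
  "SCLE_semigroup s \<gamma> T \<longleftrightarrow>
     operator_semigroup s T \<and>
     (\<forall>t\<ge>0. continuous_map \<gamma> \<gamma> (T t)) \<and>
     (\<forall>x. continuous_map (top_of_set {0..}) \<gamma> (\<lambda>t. T t x)) \<and>
     (\<forall>t\<ge>0. \<forall>p. continuous_seminorm s \<gamma> p \<longrightarrow>
        (\<exists>q. continuous_seminorm s \<gamma> q \<and> (\<forall>x. \<forall>u\<in>{0..t}. p (T u x) \<le> q x)))"

section \<open>Existence of the strongest topologies\<close>

lemma strongest_topology_eqI:
  assumes "is_strongest_topology P \<sigma>"
  shows "strongest_topology P = \<sigma>"
  unfolding strongest_topology_def
proof (rule the_equality)
  show "is_strongest_topology P \<sigma>" by fact
  show "\<sigma>' = \<sigma>" if "is_strongest_topology P \<sigma>'" for \<sigma>'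
    using that assms unfolding is_strongest_topology_def coarser_topology_def topology_eq by blast
qed

definition sup_topology :: "('a topology \<Rightarrow> bool) \<Rightarrow> 'a topology" where
  "sup_topology P = topology_generated_by {U. \<exists>\<sigma>. P \<sigma> \<and> openin \<sigma> U}"

lemma coarser_sup_topology: "P \<sigma> \<Longrightarrow> coarser_topology \<sigma> (sup_topology P)"
  unfolding coarser_topology_def sup_topology_def
  by (auto intro!: topology_generated_by_Basis)

lemma openin_sup_topology_induct [consumes 1, case_names Empty Int UN Basis]:
  assumes "openin (sup_topology P) U"
    and "Q {}" and "\<And>a b. Q a \<Longrightarrow> Q b \<Longrightarrow> openin (sup_topology P) a \<Longrightarrow> openin (sup_topology P) b \<Longrightarrow> Q (a \<inter> b)"
    and "\<And>K. (\<And>k. k \<in> K \<Longrightarrow> openin (sup_topology P) k \<and> Q k) \<Longrightarrow> Q (\<Union>K)"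
    and "\<And>\<sigma> a. P \<sigma> \<Longrightarrow> openin \<sigma> a \<Longrightarrow> Q a"
  shows "Q U"
  using assms(1) unfolding sup_topology_def openin_topology_generated_by_iff
proof induction
  case Empty show ?case by fact
next
  case (Int a b) then show ?case
    using assms(3) by (simp add: sup_topology_def openin_topology_generated_by_iff)
next
  case (UN K) then show ?case
    using assms(4) by (simp add: sup_topology_def openin_topology_generated_by_iff)
next
  case (Basis a) then show ?case using assms(5) by auto
qed

lemma locally_convex_sup_topology:
  fixes s :: "'k::real_normed_field \<Rightarrow> 'a::real_normed_vector \<Rightarrow> 'a"
  assumes ne: "P \<sigma>0" and lc: "\<And>\<sigma>. P \<sigma> \<Longrightarrow> locally_convex_topology s \<sigma>"
  shows "locally_convex_topology s (sup_topology P)"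
proof -
  let ?S = "sup_topology P"
  have top: "topspace ?S = UNIV"
  proof -
    have "openin \<sigma>0 UNIV"
      using lc[OF ne] unfolding locally_convex_topology_def by (metis openin_topspace)
    then have "openin ?S UNIV"
      using coarser_sup_topology[of P, OF ne] unfolding coarser_topology_def by blast
    then show ?thesis using openin_subset by blast
  qed
  have fine: "openin ?S U" if "P \<sigma>" "openin \<sigma> U" for \<sigma> U
    using coarser_sup_topology[of P, OF that(1)] that(2) unfolding coarser_topology_def by blast
  have lift: "continuous_map X ?S f"
    if "topspace X = UNIV" "\<And>\<sigma>. P \<sigma> \<Longrightarrow> continuous_map X \<sigma> f" for X :: "'b topology" and f
  proof -
    have "openin X {x. f x \<in> U}" if "openin ?S U" for U
      using that
    proof (induction rule: openin_sup_topology_induct)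
      case (Int a b) then show ?case by (simp add: Collect_conj_eq openin_Int)
    next
      case (UN K)
      have "openin X (\<Union>k\<in>K. {x. f x \<in> k})" using UN by blast
      moreover have "(\<Union>k\<in>K. {x. f x \<in> k}) = {x. f x \<in> \<Union>K}" by auto
      ultimately show ?case by simp
    next
      case (Basis \<sigma> a)
      then show ?case using \<open>\<And>\<sigma>. P \<sigma> \<Longrightarrow> continuous_map X \<sigma> f\<close> \<open>topspace X = UNIV\<close>
        unfolding continuous_map_def by fastforce
    qed simp
    then show ?thesis using that(1) top unfolding continuous_map_def by simp
  qed
  have id: "continuous_map ?S \<sigma> id" if "P \<sigma>" for \<sigma>
    using fine[OF that] lc[OF that] top
    by (auto simp: continuous_map_def locally_convex_topology_def)
  have add: "continuous_map (prod_topology ?S ?S) ?S (\<lambda>(x, y). x + y)"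
  proof (rule lift)
    show "continuous_map (prod_topology ?S ?S) \<sigma> (\<lambda>(x, y). x + y)" if "P \<sigma>" for \<sigma>
    proof -
      have "continuous_map (prod_topology ?S ?S) (prod_topology \<sigma> \<sigma>) (\<lambda>(x, y). (id x, id y))"
        using id[OF that] by (simp only: continuous_map_prod_top) blast
      from continuous_map_compose[OF this, of \<sigma> "\<lambda>(x, y). x + y"] lc[OF that]
      show ?thesis by (simp add: locally_convex_topology_def comp_def case_prod_unfold)
    qed
  qed (simp add: top)
  have mult: "continuous_map (prod_topology euclidean ?S) ?S (\<lambda>(c, x). s c x)"
  proof (rule lift)
    show "continuous_map (prod_topology euclidean ?S) \<sigma> (\<lambda>(c, x). s c x)" if "P \<sigma>" for \<sigma>
    proof -
      have "continuous_map (prod_topology euclidean ?S) (prod_topology euclidean \<sigma>) (\<lambda>(c, x). (id c, id x))"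
        using id[OF that] continuous_map_id by (simp only: continuous_map_prod_top) blast
      from continuous_map_compose[OF this, of \<sigma> "\<lambda>(c, x). s c x"] lc[OF that]
      show ?thesis by (simp add: locally_convex_topology_def comp_def case_prod_unfold)
    qed
  qed (simp add: top)
  have base: "0 \<in> U \<longrightarrow> (\<exists>V. openin ?S V \<and> 0 \<in> V \<and> V \<subseteq> U \<and> convex V)" if "openin ?S U" for U
    using that
  proof (induction rule: openin_sup_topology_induct)
    case (Int a b)
    show ?case
    proof
      assume "0 \<in> a \<inter> b"
      with Int obtain V W where "openin ?S V" "0 \<in> V" "V \<subseteq> a" "convex V"
        "openin ?S W" "0 \<in> W" "W \<subseteq> b" "convex W" by auto
      then show "\<exists>V. openin ?S V \<and> 0 \<in> V \<and> V \<subseteq> a \<inter> b \<and> convex V"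
        by (intro exI[of _ "V \<inter> W"]) (auto intro: convex_Int)
    qed
  next
    case (UN K) then show ?case by (meson UnionE Union_upper order_trans)
  next
    case (Basis \<sigma> a)
    then show ?case using lc[OF Basis(1)] fine[OF Basis(1)]
      unfolding locally_convex_topology_def by meson
  qed simp
  show ?thesis unfolding locally_convex_topology_def using top add mult base by blast
qed

lemma is_strongest_mixed_topology:
  fixes s :: "'k::real_normed_field \<Rightarrow> 'a::real_normed_vector \<Rightarrow> 'a"
  assumes "locally_convex_topology s \<tau>"
  shows "is_strongest_topology
    (\<lambda>\<sigma>. locally_convex_topology s \<sigma> \<and> (\<forall>B. bounded B \<longrightarrow> subtopology \<sigma> B = subtopology \<tau> B))
    (mixed_topology s \<tau>)"
proof -
  define P where "P \<sigma> \<longleftrightarrow> locally_convex_topology s \<sigma> \<and>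
    (\<forall>B. bounded B \<longrightarrow> subtopology \<sigma> B = subtopology \<tau> B)" for \<sigma> :: "'a topology"
  let ?S = "sup_topology P"
  have P\<tau>: "P \<tau>" using assms by (simp add: P_def)
  have "subtopology ?S B = subtopology \<tau> B" if B: "bounded B" for B
  proof -
    have "\<exists>V. openin \<tau> V \<and> U \<inter> B = V \<inter> B" if "openin ?S U" for U
      using that
    proof (induction rule: openin_sup_topology_induct)
      case Empty then show ?case by blast
    next
      case (Int a b)
      then obtain V W where "openin \<tau> V" "a \<inter> B = V \<inter> B" "openin \<tau> W" "b \<inter> B = W \<inter> B" by blast
      then show ?case by (intro exI[of _ "V \<inter> W"]) blast
    next
      case (UN K)
      then obtain V where V: "\<And>k. k \<in> K \<Longrightarrow> openin \<tau> (V k) \<and> k \<inter> B = V k \<inter> B" by metis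
      then have "openin \<tau> (\<Union>k\<in>K. V k)" by blast
      moreover have "\<Union>K \<inter> B = (\<Union>k\<in>K. V k) \<inter> B" using V by blast
      ultimately show ?case by blast
    next
      case (Basis \<sigma> a)
      then have "openin (subtopology \<tau> B) (a \<inter> B)"
        using B unfolding P_def by (metis openin_subtopology)
      then show ?case by (auto simp: openin_subtopology)
    qed
    moreover have "openin ?S U" if "openin \<tau> U" for U
      using coarser_sup_topology[of P, OF P\<tau>] that unfolding coarser_topology_def by blast
    ultimately show ?thesis unfolding topology_eq openin_subtopology by metis
  qed
  then have "P ?S"
    using locally_convex_sup_topology[of P \<tau> s, OF P\<tau>] by (simp add: P_def)
  then have "is_strongest_topology P ?S"
    unfolding is_strongest_topology_def using coarser_sup_topology[of P] by blast
  with strongest_topology_eqI[OF this] show ?thesis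
    unfolding mixed_topology_def P_def by simp
qed

lemma is_strongest_plus_topology:
  fixes s :: "'k::real_normed_field \<Rightarrow> 'a::real_normed_vector \<Rightarrow> 'a"
  assumes "locally_convex_topology s \<gamma>"
  shows "is_strongest_topology
    (\<lambda>\<sigma>. locally_convex_topology s \<sigma> \<and>
         (\<forall>(x :: nat \<Rightarrow> 'a) l. limitin \<sigma> x l sequentially \<longleftrightarrow> limitin \<gamma> x l sequentially))
    (plus_topology s \<gamma>)"
proof -
  define P where "P \<sigma> \<longleftrightarrow> locally_convex_topology s \<sigma> \<and>
    (\<forall>(x :: nat \<Rightarrow> 'a) l. limitin \<sigma> x l sequentially \<longleftrightarrow> limitin \<gamma> x l sequentially)"
    for \<sigma> :: "'a topology"
  let ?S = "sup_topology P"
  have P\<gamma>: "P \<gamma>" using assms by (simp add: P_def)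
  have lc: "locally_convex_topology s ?S"
    using locally_convex_sup_topology[of P \<gamma> s, OF P\<gamma>] by (simp add: P_def)
  have "limitin ?S x l sequentially \<longleftrightarrow> limitin \<gamma> x l sequentially" for x :: "nat \<Rightarrow> 'a" and l
  proof
    assume "limitin ?S x l sequentially"
    then show "limitin \<gamma> x l sequentially"
      using coarser_sup_topology[of P, OF P\<gamma>] assms
      by (auto simp: limitin_def coarser_topology_def locally_convex_topology_def)
  next
    assume L: "limitin \<gamma> x l sequentially"
    have "l \<in> U \<longrightarrow> eventually (\<lambda>n. x n \<in> U) sequentially" if "openin ?S U" for U
      using that
    proof (induction rule: openin_sup_topology_induct)
      case (Int a b) then show ?case by (auto intro: eventually_conj)
    next
      case (UN K)
      show ?case
      proof
        assume "l \<in> \<Union>K"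
        then obtain k where k: "k \<in> K" "l \<in> k" by blast
        with UN[of k] have "eventually (\<lambda>n. x n \<in> k) sequentially" by simp
        then show "eventually (\<lambda>n. x n \<in> \<Union>K) sequentially"
          by (rule eventually_mono) (use k in blast)
      qed
    next
      case (Basis \<sigma> a)
      then show ?case using L unfolding P_def by (metis limitin_def)
    qed simp
    then show "limitin ?S x l sequentially"
      using lc by (simp add: limitin_def locally_convex_topology_def)
  qed
  then have "P ?S" using lc by (simp add: P_def)
  then have "is_strongest_topology P ?S"
    unfolding is_strongest_topology_def using coarser_sup_topology[of P] by blast
  with strongest_topology_eqI[OF this] show ?thesis
    unfolding plus_topology_def P_def by simp
qed

end

theory Submission
  imports Defs
begin

text \<open>
  The proof rests on three facts about seminorms.  A seminorm that is \<open>\<tau>\<close>-continuous at \<open>0\<close> on bounded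
  sets is \<open>\<gamma>\<close>-continuous, by maximality of the mixed topology.  If \<open>\<gamma>\<^sup>+ = \<gamma>\<close>, a seminorm that is
  sequentially \<open>\<gamma>\<close>-continuous at \<open>0\<close> is \<open>\<gamma>\<close>-continuous, by maximality of \<open>\<gamma>\<^sup>+\<close>.  A set on which all
  \<open>\<gamma>\<close>-continuous seminorms are bounded is norm bounded, because the dual is norming.  Hence the
  \<open>\<gamma>\<close>-null sequences are exactly the norm bounded \<open>\<tau>\<close>-null sequences.

  If \<open>T\<close> is bi-continuous and \<open>p\<close> is a \<open>\<gamma>\<close>-continuous seminorm, then \<open>q x = sup\<^bsub>u \<le> t\<^esub> p (T u x)\<close> tends
  to \<open>0\<close> along \<open>\<gamma>\<close>-null sequences, so \<open>q\<close> is \<open>\<gamma>\<close>-continuous.  Conversely, if \<open>T\<close> is SCLE, then every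
  \<open>\<gamma>\<close>-continuous seminorm is bounded on the image of the unit ball under \<open>{T u | u \<le> 1}\<close>; this gives
  the exponential norm bound, and local bi-continuity follows from the estimate \<open>p (T u x) \<le> q x\<close>.
\<close>

section \<open>Seminorms and locally convex topologies\<close>

text \<open>The open sets satisfy \<open>istopology\<close> for an arbitrary function
  \<open>p\<close>; the triangle inequality enters only later, when balls are shown to be
  open.\<close>

definition seminorm_topology :: "('a::ab_group_add \<Rightarrow> real) \<Rightarrow> 'a topology" where
  "seminorm_topology p = topology (\<lambda>U. \<forall>x\<in>U. \<exists>e>0. \<forall>y. p (y - x) < e \<longrightarrow> y \<in> U)"

lemma openin_seminorm_topology:
  "openin (seminorm_topology p) U \<longleftrightarrow> (\<forall>x\<in>U. \<exists>e>0. \<forall>y. p (y - x) < e \<longrightarrow> y \<in> U)"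
proof -
  have "istopology (\<lambda>U. \<forall>x\<in>U. \<exists>e>0. \<forall>y. p (y - x) < e \<longrightarrow> y \<in> U)"
    unfolding istopology_def
  proof (intro conjI allI impI ballI)
    fix U V x
    assume "\<forall>x\<in>U. \<exists>e>0. \<forall>y. p (y - x) < e \<longrightarrow> y \<in> U"
      "\<forall>x\<in>V. \<exists>e>0. \<forall>y. p (y - x) < e \<longrightarrow> y \<in> V" "x \<in> U \<inter> V"
    then obtain d e where "0 < d" "\<forall>y. p (y - x) < d \<longrightarrow> y \<in> U" "0 < e" "\<forall>y. p (y - x) < e \<longrightarrow> y \<in> V"
      by blast
    then show "\<exists>e>0. \<forall>y. p (y - x) < e \<longrightarrow> y \<in> U \<inter> V"
      by (intro exI[of _ "min d e"]) auto
  next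
    fix K x
    assume K: "\<forall>U\<in>K. \<forall>x\<in>U. \<exists>e>0. \<forall>y. p (y - x) < e \<longrightarrow> y \<in> U" "x \<in> \<Union>K"
    then obtain U e where "U \<in> K" "0 < e" "\<forall>y. p (y - x) < e \<longrightarrow> y \<in> U" by blast
    then show "\<exists>e>0. \<forall>y. p (y - x) < e \<longrightarrow> y \<in> \<Union>K" by blast
  qed
  then show ?thesis by (simp add: seminorm_topology_def topology_inverse')
qed

section \<open>Elementary rules for seminorms\<close>

context
  fixes s :: "'k::real_normed_field \<Rightarrow> 'a::real_normed_vector \<Rightarrow> 'a"
  assumes normed_space: "normed_space_over s"
begin

lemma vector_space_scalars: "vector_space s"
  using normed_space by (simp add: normed_space_over_def)

interpretation S: vector_space s
  by (rule vector_space_scalars)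

lemma scale_of_real: "s (of_real r) x = r *\<^sub>R x"
  using normed_space by (simp add: normed_space_over_def)

lemma norm_scale: "norm (s c x) = norm c * norm x"
  using normed_space by (simp add: normed_space_over_def)

lemma scale_scaleR: "s c (r *\<^sub>R x) = r *\<^sub>R s c x"
  by (metis scale_of_real S.scale_left_commute)

text \<open>The upper estimate for scalar multiples suffices: applied to \<open>inverse c\<close>
  and \<open>s c x\<close> it gives the lower one. The case \<open>c = 0\<close> is covered by
  \<open>p 0 = 0\<close>.\<close>

lemma seminormI:
  assumes "\<And>x. 0 \<le> p x" "\<And>x y. p (x + y) \<le> p x + p y"
    and le: "\<And>c x. c \<noteq> 0 \<Longrightarrow> p (s c x) \<le> norm c * p x" and "p 0 = 0"
  shows "seminorm s p"
proof -
  have "norm c * p x \<le> p (s c x)" if "c \<noteq> 0" for c x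
    using le[of "inverse c" "s c x"] that by (simp add: norm_inverse) (simp add: divide_simps mult.commute)
  with assms show ?thesis
    unfolding seminorm_def by (metis S.scale_zero_left antisym mult_zero_left norm_zero)
qed

lemma seminorm_nonneg: "seminorm s p \<Longrightarrow> 0 \<le> p x"
  and seminorm_add: "seminorm s p \<Longrightarrow> p (x + y) \<le> p x + p y"
  and seminorm_scale: "seminorm s p \<Longrightarrow> p (s c x) = norm c * p x"
  by (auto simp: seminorm_def)

lemma seminorm_scaleR: "seminorm s p \<Longrightarrow> p (r *\<^sub>R x) = \<bar>r\<bar> * p x"
  using seminorm_scale[of p "of_real r" x] by (simp add: scale_of_real)

lemma seminorm_zero: "seminorm s p \<Longrightarrow> p 0 = 0"
  using seminorm_scaleR[of p 0 0] by simp

lemma seminorm_minus: "seminorm s p \<Longrightarrow> p (- x) = p x"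
  using seminorm_scaleR[of p "-1" x] by simp

lemma seminorm_diff_triangle: "seminorm s p \<Longrightarrow> p (x - z) \<le> p (x - y) + p (y - z)"
  using seminorm_add[of p "x - y" "y - z"] by simp

lemma seminorm_abs_diff:
  assumes "seminorm s p" shows "\<bar>p x - p y\<bar> \<le> p (x - y)"
  using seminorm_add[OF assms, of "x - y" y] seminorm_add[OF assms, of "y - x" x]
    seminorm_minus[OF assms, of "x - y"] by simp

text \<open>Nonempty \<open>I\<close> and pointwise bounds make the real \<open>SUP\<close> a
  genuine supremum. Both auxiliary seminorms of the proof arise this way: weighted functionals, and
  suprema along orbits.\<close>

lemma seminorm_SUP:
  assumes "I \<noteq> {}" and sn: "\<And>i. i \<in> I \<Longrightarrow> seminorm s (p i)"
    and bdd: "\<And>x. bdd_above ((\<lambda>i. p i x) ` I)"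
  shows "seminorm s (\<lambda>x. SUP i\<in>I. p i x)"
proof (rule seminormI)
  have upper: "p i x \<le> (SUP i\<in>I. p i x)" if "i \<in> I" for i x
    by (rule cSUP_upper[OF that bdd])
  from \<open>I \<noteq> {}\<close> obtain j where j: "j \<in> I" by blast
  show "0 \<le> (SUP i\<in>I. p i x)" for x
    using upper[OF j, of x] seminorm_nonneg[OF sn[OF j], of x] by linarith
  show "(SUP i\<in>I. p i (x + y)) \<le> (SUP i\<in>I. p i x) + (SUP i\<in>I. p i y)" for x y
    using upper seminorm_add[OF sn] by (intro cSUP_least[OF \<open>I \<noteq> {}\<close>]) (meson add_mono order_trans)
  show "(SUP i\<in>I. p i (s c x)) \<le> norm c * (SUP i\<in>I. p i x)" for c x
    using upper by (intro cSUP_least[OF \<open>I \<noteq> {}\<close>]) (simp add: seminorm_scale[OF sn] mult_left_mono)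
  show "(SUP i\<in>I. p i 0) = 0"
    using \<open>I \<noteq> {}\<close> by (simp add: seminorm_zero[OF sn] cong: SUP_cong)
qed

text \<open>If \<open>U\<close> contains the ball of radius \<open>d\<close>, scaling
  \<open>x\<close> to norm \<open>d / 2\<close> gives the constant \<open>2 / d\<close>.\<close>

lemma seminorm_le_norm:
  assumes p: "seminorm s p" and U: "open U" "0 \<in> U" "\<And>x. x \<in> U \<Longrightarrow> p x \<le> 1"
  obtains C where "0 < C" "\<And>x. p x \<le> C * norm x"
proof -
  obtain d where d: "0 < d" "ball 0 d \<subseteq> U"
    using U(1,2) open_contains_ball by blast
  have "p x \<le> 2 / d * norm x" for x
  proof (cases "x = 0")
    case True then show ?thesis by (simp add: seminorm_zero[OF p])
  next
    case False
    define r where "r = d / (2 * norm x)"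
    have r: "0 < r" using d(1) False by (simp add: r_def)
    have "norm (r *\<^sub>R x) < d" using d(1) False by (simp add: r_def)
    then have "p (r *\<^sub>R x) \<le> 1" using d(2) U(3) by (simp add: subset_iff)
    then have "p x \<le> 1 / r" using r by (simp add: seminorm_scaleR[OF p] field_simps)
    then show ?thesis by (simp add: r_def field_simps)
  qed
  then show thesis using that[of "2 / d"] d(1) by simp
qed

subsection \<open>The topology of a single seminorm\<close>

lemma openin_seminorm_ball:
  assumes p: "seminorm s p" shows "openin (seminorm_topology p) {y. p (y - x) < e}"
  unfolding openin_seminorm_topology
proof (intro ballI)
  fix z assume z: "z \<in> {y. p (y - x) < e}"
  have "p (y - x) < e" if "p (y - z) < e - p (z - x)" for y
    using seminorm_diff_triangle[OF p, of y x z] that by linarith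
  then show "\<exists>d>0. \<forall>y. p (y - z) < d \<longrightarrow> y \<in> {y. p (y - x) < e}"
    using z by (intro exI[of _ "e - p (z - x)"]) auto
qed

lemma convex_seminorm_ball:
  assumes p: "seminorm s p" shows "convex {x. p x < e}"
  unfolding convex_def
proof (intro ballI allI impI)
  fix x y and u v :: real assume *: "x \<in> {x. p x < e}" "y \<in> {x. p x < e}" "0 \<le> u" "0 \<le> v" "u + v = 1"
  have "p (u *\<^sub>R x + v *\<^sub>R y) \<le> u * p x + v * p y"
    using seminorm_add[OF p, of "u *\<^sub>R x" "v *\<^sub>R y"] *(3,4) by (simp add: seminorm_scaleR[OF p])
  also have "\<dots> < e" using * by (intro convex_bound_lt) auto
  finally show "u *\<^sub>R x + v *\<^sub>R y \<in> {x. p x < e}" by simp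
qed

text \<open>Makes the join of this topology with \<open>\<gamma>\<close> locally convex, hence a
  competitor in the maximality properties that define the mixed and the plus topology.\<close>

lemma locally_convex_seminorm_topology:
  assumes p: "seminorm s p" shows "locally_convex_topology s (seminorm_topology p)"
proof -
  let ?T = "seminorm_topology p"
  note p0 = seminorm_zero[OF p] and nn = seminorm_nonneg[OF p]
  have "openin ?T UNIV" by (auto simp: openin_seminorm_topology intro: exI[of _ 1])
  then have top: "topspace ?T = UNIV" using openin_subset by blast
  have add: "continuous_map (prod_topology ?T ?T) ?T (\<lambda>(x, y). x + y)"
    unfolding continuous_map_def
  proof (intro conjI allI impI)
    fix U assume U: "openin ?T U"
    show "openin (prod_topology ?T ?T) {z \<in> topspace (prod_topology ?T ?T). (\<lambda>(x, y). x + y) z \<in> U}"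
      unfolding openin_prod_topology_alt
    proof (intro allI impI)
      fix x y assume "(x, y) \<in> {z \<in> topspace (prod_topology ?T ?T). (\<lambda>(x, y). x + y) z \<in> U}"
      then obtain e where e: "0 < e" "\<And>w. p (w - (x + y)) < e \<Longrightarrow> w \<in> U"
        using U by (auto simp: openin_seminorm_topology)
      have "x' + y' \<in> U" if "p (x' - x) < e / 2" "p (y' - y) < e / 2" for x' y'
      proof (rule e(2))
        have "p ((x' + y') - (x + y)) \<le> p (x' - x) + p (y' - y)"
          using seminorm_add[OF p, of "x' - x" "y' - y"] by (simp add: algebra_simps)
        with that show "p ((x' + y') - (x + y)) < e" by linarith
      qed
      then show "\<exists>V W. openin ?T V \<and> openin ?T W \<and> x \<in> V \<and> y \<in> W \<and>
          V \<times> W \<subseteq> {z \<in> topspace (prod_topology ?T ?T). (\<lambda>(x, y). x + y) z \<in> U}"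
        using e(1)
        by (rule_tac exI[of _ "{z. p (z - x) < e / 2}"], rule_tac exI[of _ "{z. p (z - y) < e / 2}"])
          (simp add: top p0 openin_seminorm_ball[OF p] subset_iff del: less_divide_eq_numeral1)
    qed
  qed (simp add: top)
  have mult: "continuous_map (prod_topology euclidean ?T) ?T (\<lambda>(c, x). s c x)"
    unfolding continuous_map_def
  proof (intro conjI allI impI)
    fix U assume U: "openin ?T U"
    show "openin (prod_topology euclidean ?T) {z \<in> topspace (prod_topology euclidean ?T). (\<lambda>(c, x). s c x) z \<in> U}"
      unfolding openin_prod_topology_alt
    proof (intro allI impI)
      fix c x assume "(c, x) \<in> {z \<in> topspace (prod_topology euclidean ?T). (\<lambda>(c, x). s c x) z \<in> U}"
      then obtain e where e: "0 < e" "\<And>w. p (w - s c x) < e \<Longrightarrow> w \<in> U"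
        using U by (auto simp: openin_seminorm_topology)
      \<comment> \<open>The radii are read off from
        \<open>s c' x' - s c x = s c' (x' - x) + s (c' - c) x\<close>: each summand may cost
        \<open>e / 2\<close>. Capping \<open>r\<close> at 1 gives
        \<open>norm c' \<le> norm c + 1\<close>, and \<open>p x + 1\<close> avoids a zero
        denominator.\<close>
      define d where "d = e / (2 * (norm c + 1))"
      define r where "r = min 1 (e / (2 * (p x + 1)))"
      have d: "0 < d" using e(1) by (simp add: d_def add_nonneg_pos)
      have r: "0 < r" "r \<le> 1" using e(1) nn[of x] by (simp_all add: r_def)
      have "s c' x' \<in> U" if "dist c' c < r" "p (x' - x) < d" for c' x'
      proof (rule e(2))
        have nc: "norm c' \<le> norm c + 1"
          using norm_triangle_sub[of c' c] that(1) r by (simp add: dist_norm)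
        have 1: "norm c' * p (x' - x) \<le> (norm c + 1) * p (x' - x)"
          using nc nn by (rule mult_right_mono)
        have 2: "(norm c + 1) * p (x' - x) < (norm c + 1) * d"
          using that(2) by (intro mult_strict_left_mono) (auto simp: add_nonneg_pos)
        have "d = (e / 2) / (norm c + 1)" by (simp add: d_def)
        moreover have "norm c + 1 \<noteq> 0" using norm_ge_zero[of c] by linarith
        ultimately have 3: "(norm c + 1) * d = e / 2" by (metis nonzero_mult_div_cancel_left times_divide_eq_right)
        have 4: "norm (c' - c) * p x \<le> r * (p x + 1)"
          using that(1) nn[of x] r by (intro mult_mono) (auto simp: dist_norm)
        have 5: "r * (p x + 1) \<le> e / (2 * (p x + 1)) * (p x + 1)"
          using nn[of x] by (intro mult_right_mono) (auto simp: r_def)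
        have 6: "e / (2 * (p x + 1)) * (p x + 1) = e / 2"
          using nn[of x] by (simp add: field_simps)
        have "s c' x' - s c x = s c' (x' - x) + s (c' - c) x"
          by (simp add: S.scale_right_diff_distrib S.scale_left_diff_distrib)
        then have "p (s c' x' - s c x) \<le> norm c' * p (x' - x) + norm (c' - c) * p x"
          using seminorm_add[OF p, of "s c' (x' - x)" "s (c' - c) x"] by (simp add: seminorm_scale[OF p])
        then show "p (s c' x' - s c x) < e" using 1 2 3 4 5 6 by linarith
      qed
      then show "\<exists>V W. openin euclidean V \<and> openin ?T W \<and> c \<in> V \<and> x \<in> W \<and>
          V \<times> W \<subseteq> {z \<in> topspace (prod_topology euclidean ?T). (\<lambda>(c, x). s c x) z \<in> U}"
        using d r by (intro exI[of _ "ball c r"] exI[of _ "{z. p (z - x) < d}"])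
          (auto simp: top p0 openin_seminorm_ball[OF p] dist_commute)
    qed
  qed (simp add: top)
  have "\<exists>V. openin ?T V \<and> 0 \<in> V \<and> V \<subseteq> U \<and> convex V" if "openin ?T U" "0 \<in> U" for U
  proof -
    from that(1) have "\<forall>x\<in>U. \<exists>e>0. \<forall>y. p (y - x) < e \<longrightarrow> y \<in> U"
      by (simp only: openin_seminorm_topology)
    from bspec[OF this that(2)] obtain e where "0 < e" "{y. p y < e} \<subseteq> U" by auto
    moreover have "openin ?T {y. p y < e}" using openin_seminorm_ball[OF p, of 0 e] by simp
    ultimately show ?thesis
      using convex_seminorm_ball[OF p, of e] p0 by (intro exI[of _ "{y. p y < e}"]) simp
  qed
  then show ?thesis
    unfolding locally_convex_topology_def using top add mult by blast
qed

subsection \<open>Neighbourhoods in a locally convex topology\<close>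

context
  fixes \<sigma> :: "'a topology"
  assumes lc: "locally_convex_topology s \<sigma>"
begin

lemma topspace_lc: "topspace \<sigma> = UNIV"
  using lc by (simp add: locally_convex_topology_def)

lemma openin_translate:
  assumes "openin \<sigma> U" shows "openin \<sigma> {x. x + a \<in> U}"
proof -
  have "continuous_map \<sigma> (prod_topology \<sigma> \<sigma>) (\<lambda>x. (x, a))"
    by (simp add: continuous_map_pairedI topspace_lc)
  then have "continuous_map \<sigma> \<sigma> ((\<lambda>(x, y). x + y) \<circ> (\<lambda>x. (x, a)))"
    using lc by (auto simp: locally_convex_topology_def intro: continuous_map_compose)
  from openin_continuous_map_preimage[OF this assms] show ?thesis
    by (simp add: topspace_lc)
qed

lemma openin_translate_diff:
  assumes "openin \<sigma> U" shows "openin \<sigma> {x. x - a \<in> U}"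
  using openin_translate[OF assms, of "- a"] by simp

lemma openin_scale:
  assumes "openin \<sigma> U" shows "openin \<sigma> {x. s c x \<in> U}"
proof -
  have "continuous_map \<sigma> (prod_topology euclidean \<sigma>) (\<lambda>x. (c, x))"
    by (simp add: continuous_map_pairedI)
  then have "continuous_map \<sigma> \<sigma> ((\<lambda>(c, x). s c x) \<circ> (\<lambda>x. (c, x)))"
    using lc by (auto simp: locally_convex_topology_def intro: continuous_map_compose)
  from openin_continuous_map_preimage[OF this assms] show ?thesis
    by (simp add: topspace_lc)
qed

lemma openin_scaleR:
  assumes "openin \<sigma> U" shows "openin \<sigma> {x. r *\<^sub>R x \<in> U}"
  using openin_scale[OF assms, of "of_real r"] by (simp add: scale_of_real)

lemma limitin_diff:
  "limitin \<sigma> x l F \<longleftrightarrow> (\<forall>U. openin \<sigma> U \<and> 0 \<in> U \<longrightarrow> (\<forall>\<^sub>F n in F. x n - l \<in> U))"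
proof
  assume L: "limitin \<sigma> x l F"
  show "\<forall>U. openin \<sigma> U \<and> 0 \<in> U \<longrightarrow> (\<forall>\<^sub>F n in F. x n - l \<in> U)"
  proof (intro allI impI)
    fix U assume "openin \<sigma> U \<and> 0 \<in> U"
    then have "openin \<sigma> {x. x - l \<in> U}" "l \<in> {x. x - l \<in> U}"
      using openin_translate_diff by auto
    then have "\<forall>\<^sub>F n in F. x n \<in> {x. x - l \<in> U}" using L unfolding limitin_def by blast
    then show "\<forall>\<^sub>F n in F. x n - l \<in> U" by simp
  qed
next
  assume R: "\<forall>U. openin \<sigma> U \<and> 0 \<in> U \<longrightarrow> (\<forall>\<^sub>F n in F. x n - l \<in> U)"
  have "\<forall>\<^sub>F n in F. x n \<in> U" if "openin \<sigma> U" "l \<in> U" for U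
    using R openin_translate[OF that(1), of l] that(2) by fastforce
  then show "limitin \<sigma> x l F" by (simp add: limitin_def topspace_lc)
qed

lemma limitin_diff_zero: "limitin \<sigma> (\<lambda>n. x n - l) 0 F \<longleftrightarrow> limitin \<sigma> x l F"
  by (simp add: limitin_diff[of x] limitin_diff[of "\<lambda>n. x n - l"])

text \<open>Smallness near 0 spreads to every point, by
  \<open>\<bar>p y - p x\<bar> \<le> p (y - x)\<close> and the openness of translates.\<close>

lemma continuous_seminormI:
  assumes p: "seminorm s p"
    and V: "\<And>e. 0 < e \<Longrightarrow> \<exists>V. openin \<sigma> V \<and> 0 \<in> V \<and> (\<forall>x\<in>V. p x < e)"
  shows "continuous_seminorm s \<sigma> p"
proof -
  have "openin \<sigma> {x. p x \<in> U}" if "open U" for U :: "real set"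
  proof (subst openin_subopen, intro ballI)
    fix x assume "x \<in> {x. p x \<in> U}"
    then obtain e where e: "0 < e" "ball (p x) e \<subseteq> U"
      using \<open>open U\<close> open_contains_ball by (metis mem_Collect_eq)
    obtain V where V: "openin \<sigma> V" "0 \<in> V" "\<And>x. x \<in> V \<Longrightarrow> p x < e" using V[OF e(1)] by blast
    have "p y \<in> U" if "y - x \<in> V" for y
      using V(3)[OF that] seminorm_abs_diff[OF p, of y x] e(2)
      by (auto simp: subset_iff dist_real_def)
    then show "\<exists>T. openin \<sigma> T \<and> x \<in> T \<and> T \<subseteq> {x. p x \<in> U}"
      using openin_translate_diff[OF V(1), of x] V(2) by (intro exI[of _ "{y. y - x \<in> V}"]) auto
  qed
  then show ?thesis
    using p by (simp add: continuous_seminorm_def continuous_map_def topspace_lc)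
qed

lemma openin_continuous_seminorm_ball:
  assumes "continuous_seminorm s \<sigma> p" shows "openin \<sigma> {x. p x < e}"
proof -
  have "continuous_map \<sigma> euclideanreal p" using assms by (simp add: continuous_seminorm_def)
  from openin_continuous_map_preimage[OF this, of "{..<e}"] show ?thesis
    by (simp add: topspace_lc)
qed

text \<open>\<open>D\<close> is the balanced core of a convex open \<open>V\<close> inside
  \<open>U\<close>. Its openness is not claimed; joint continuity of scalar multiplication at
  \<open>(0, 0)\<close> supplies the open set \<open>W\<close> inside it.\<close>

lemma balanced_convex_neighbourhood:
  assumes "openin \<sigma> U" "0 \<in> U"
  obtains D W where "convex D" "\<And>c x. norm c \<le> 1 \<Longrightarrow> x \<in> D \<Longrightarrow> s c x \<in> D" "D \<subseteq> U"
    "openin \<sigma> W" "0 \<in> W" "W \<subseteq> D"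
proof -
  obtain V where V: "openin \<sigma> V" "0 \<in> V" "V \<subseteq> U" "convex V"
    using lc assms unfolding locally_convex_topology_def by meson
  have "continuous_map (prod_topology euclidean \<sigma>) \<sigma> (\<lambda>(c, x). s c x)"
    using lc by (simp add: locally_convex_topology_def)
  from openin_continuous_map_preimage[OF this V(1)]
  have "openin (prod_topology euclidean \<sigma>) {z. s (fst z) (snd z) \<in> V}"
    by (simp add: topspace_lc case_prod_unfold)
  then have "\<forall>c x. (c, x) \<in> {z. s (fst z) (snd z) \<in> V} \<longrightarrow> (\<exists>C W. openin euclidean C \<and> openin \<sigma> W \<and>
      c \<in> C \<and> x \<in> W \<and> C \<times> W \<subseteq> {z. s (fst z) (snd z) \<in> V})"
    by (simp only: openin_prod_topology_alt)
  from this[rule_format, of 0 0] obtain C W where CW: "open C" "openin \<sigma> W" "0 \<in> C" "0 \<in> W"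
      "C \<times> W \<subseteq> {z. s (fst z) (snd z) \<in> V}"
    using V(2) by auto
  then obtain d where d: "0 < d" "ball 0 d \<subseteq> C" using open_contains_ball by blast
  define D where "D = {x. \<forall>c. norm c \<le> 1 \<longrightarrow> s c x \<in> V}"
  have "convex D"
    unfolding convex_def D_def
    using V(4) by (auto simp: S.scale_right_distrib scale_scaleR convexD)
  moreover have "s c x \<in> D" if "norm c \<le> 1" "x \<in> D" for c x
    using that by (auto simp: D_def norm_mult mult_le_one)
  moreover have "D \<subseteq> U"
    using V(3) unfolding D_def by (metis (mono_tags, lifting) S.scale_one mem_Collect_eq norm_one order_refl subset_iff)
  \<comment> \<open>Splitting \<open>s c x\<close> as the scalar \<open>c * of_real (d / 2)\<close>
    applied to \<open>(2 / d) *\<^sub>R x\<close> puts the scalar into \<open>C\<close> and the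
    vector into \<open>W\<close>.\<close>
  moreover have "{x. (2 / d) *\<^sub>R x \<in> W} \<subseteq> D"
  proof
    fix x assume x: "x \<in> {x. (2 / d) *\<^sub>R x \<in> W}"
    have "s c x \<in> V" if "norm c \<le> 1" for c
    proof -
      have "norm (c * of_real (d / 2)) < d"
        using that d(1) mult_left_mono[OF that, of "d / 2"] by (simp add: norm_mult)
      then have "c * of_real (d / 2) \<in> C" using d(2) by (auto simp: subset_iff)
      with x CW(5) have "s (c * of_real (d / 2)) ((2 / d) *\<^sub>R x) \<in> V" by auto
      moreover have "s (c * of_real (d / 2)) ((2 / d) *\<^sub>R x) = s c ((d / 2) *\<^sub>R (2 / d) *\<^sub>R x)"
        by (metis S.scale_scale scale_of_real)
      ultimately show ?thesis using d(1) by simp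
    qed
    then show "x \<in> D" by (simp add: D_def)
  qed
  ultimately show thesis
    using that openin_scaleR[OF CW(2), of "2 / d"] CW(4) by auto
qed

text \<open>Follows from continuity of \<open>c \<mapsto> s c x\<close> at 0. It keeps the infimum
  in the Minkowski functional from being taken over the empty set.\<close>

lemma absorbing_neighbourhood:
  assumes "openin \<sigma> W" "0 \<in> W"
  obtains r where "0 < r" "(1 / r) *\<^sub>R x \<in> W"
proof -
  have "continuous_map euclidean (prod_topology euclidean \<sigma>) (\<lambda>c. (c, x))"
    by (simp add: continuous_map_pairedI topspace_lc)
  then have "continuous_map euclidean \<sigma> ((\<lambda>(c, x). s c x) \<circ> (\<lambda>c. (c, x)))"
    using lc by (auto simp: locally_convex_topology_def intro: continuous_map_compose)
  from openin_continuous_map_preimage[OF this assms(1)]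
  have "open {c. s c x \<in> W}" by simp
  moreover have "0 \<in> {c. s c x \<in> W}" using assms(2) by simp
  ultimately obtain d where d: "0 < d" "ball 0 d \<subseteq> {c. s c x \<in> W}"
    using open_contains_ball by blast
  have "of_real (d / 2) \<in> ball (0 :: 'k) d" using d(1) by (simp add: norm_divide)
  then have "s (of_real (d / 2)) x \<in> W" using d(2) by blast
  then show thesis using that[of "2 / d"] d(1) unfolding scale_of_real by simp
qed

text \<open>The seminorm is the Minkowski functional of a convex balanced neighbourhood.\<close>

lemma continuous_seminorm_neighbourhood:
  assumes "openin \<sigma> U" "0 \<in> U"
  obtains p where "continuous_seminorm s \<sigma> p" "\<And>x. p x < 1 \<Longrightarrow> x \<in> U"
proof -
  obtain D W where D: "convex D" "\<And>c x. norm c \<le> 1 \<Longrightarrow> x \<in> D \<Longrightarrow> s c x \<in> D" "D \<subseteq> U"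
    and W: "openin \<sigma> W" "0 \<in> W" "W \<subseteq> D"
    using balanced_convex_neighbourhood[OF assms] by metis
  \<comment> \<open>Positivity of \<open>r\<close> matters: since \<open>1 / 0 = 0\<close>, the
    value \<open>r = 0\<close> would otherwise belong to every \<open>A x\<close>.\<close>
  define A where "A x = {r. 0 < r \<and> (1 / r) *\<^sub>R x \<in> D}" for x
  define p where "p x = Inf (A x)" for x
  have ne: "A x \<noteq> {}" for x
    using absorbing_neighbourhood[OF W(1,2), of x] W(3) by (auto simp: A_def)
  have bdd: "bdd_below (A x)" for x by (rule bdd_belowI[of _ 0]) (auto simp: A_def)
  have lower: "p x \<le> r" if "r \<in> A x" for r x
    unfolding p_def by (rule cInf_lower[OF that bdd])
  have nn: "0 \<le> p x" for x
    unfolding p_def by (rule cInf_greatest[OF ne]) (auto simp: A_def)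
  have add: "p (x + y) \<le> p x + p y" for x y
  proof -
    have "p (x + y) \<le> r + t" if "r \<in> A x" "t \<in> A y" for r t
    proof (rule lower)
      have rt: "0 < r" "0 < t" "(1 / r) *\<^sub>R x \<in> D" "(1 / t) *\<^sub>R y \<in> D" using that by (auto simp: A_def)
      \<comment> \<open>This convex combination equals
        \<open>(1 / (r + t)) *\<^sub>R (x + y)\<close>.\<close>
      have "(r / (r + t)) *\<^sub>R ((1 / r) *\<^sub>R x) + (t / (r + t)) *\<^sub>R ((1 / t) *\<^sub>R y) \<in> D"
        using rt by (intro convexD[OF D(1)]) (auto simp: add_divide_distrib[symmetric])
      then show "r + t \<in> A (x + y)" using rt by (simp add: A_def scaleR_add_right)
    qed
    then have "p (x + y) - t \<le> p x" if "t \<in> A y" for t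
      unfolding p_def[of x] using that by (intro cInf_greatest[OF ne]) (simp add: diff_le_eq)
    then have "p (x + y) - p x \<le> p y"
      unfolding p_def[of y] by (intro cInf_greatest[OF ne]) (simp add: algebra_simps)
    then show ?thesis by simp
  qed
  have scale: "p (s c x) \<le> norm c * p x" if "c \<noteq> 0" for c x
  proof -
    have "p (s c x) \<le> norm c * r" if r: "r \<in> A x" for r
    proof (rule lower)
      \<comment> \<open>The scalar has norm 1, so balancedness of \<open>D\<close> applies; the
        remaining factor \<open>norm c\<close> is real and moves into \<open>r\<close>.\<close>
      have "s (c / of_real (norm c)) ((1 / r) *\<^sub>R x) \<in> D"
        using r \<open>c \<noteq> 0\<close> by (intro D(2)) (auto simp: A_def norm_divide)
      moreover have "s (c / of_real (norm c)) ((1 / r) *\<^sub>R x) = (1 / (norm c * r)) *\<^sub>R s c x"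
      proof -
        have "s (c / of_real (norm c)) y = (1 / norm c) *\<^sub>R s c y" for y
          using scale_of_real[of "1 / norm c" "s c y"] by (simp add: field_simps)
        then show ?thesis by (simp add: scale_scaleR)
      qed
      ultimately show "norm c * r \<in> A (s c x)" using r \<open>c \<noteq> 0\<close> by (simp add: A_def)
    qed
    then have "p (s c x) / norm c \<le> p x"
      unfolding p_def[of x] using that by (intro cInf_greatest[OF ne]) (simp add: field_simps)
    then show ?thesis using that by (simp add: field_simps)
  qed
  have "p 0 \<le> e" if "0 < e" for e
    using W that by (intro lower) (auto simp: A_def)
  then have "p 0 = 0" using nn[of 0] field_le_epsilon[of "p 0" 0] by simp
  with nn add scale have p: "seminorm s p" by (rule seminormI)
  have "\<exists>V. openin \<sigma> V \<and> 0 \<in> V \<and> (\<forall>x\<in>V. p x < e)" if e: "0 < e" for e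
  proof (intro exI conjI ballI)
    show "openin \<sigma> {x. (2 / e) *\<^sub>R x \<in> W}" by (rule openin_scaleR[OF W(1)])
    show "p x < e" if "x \<in> {x. (2 / e) *\<^sub>R x \<in> W}" for x
      using lower[of "e / 2" x] that W(3) e by (auto simp: A_def)
  qed (use W in simp)
  with p have "continuous_seminorm s \<sigma> p" by (rule continuous_seminormI)
  moreover have "x \<in> U" if px: "p x < 1" for x
  proof -
    obtain r where r: "r \<in> A x" "r < 1"
      using cInf_lessD[OF ne[of x], of 1] px by (auto simp: p_def)
    then have "s (of_real r) ((1 / r) *\<^sub>R x) \<in> D" by (intro D(2)) (auto simp: A_def)
    then have "x \<in> D" using r(1) by (simp add: scale_of_real A_def)
    then show ?thesis using D(3) by blast
  qed
  ultimately show thesis using that by blast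
qed

end

end

section \<open>Seminorms continuous for the mixed topology\<close>

text \<open>Turns continuity of \<open>p\<close> into a comparison of topologies, which is what
  maximality delivers.\<close>

lemma continuous_seminorm_if_coarser:
  assumes "normed_space_over s" "locally_convex_topology s \<sigma>" "seminorm s p"
    "coarser_topology (seminorm_topology p) \<sigma>"
  shows "continuous_seminorm s \<sigma> p"
proof (rule continuous_seminormI[OF assms(1-3)])
  fix e :: real assume "0 < e"
  moreover have "openin \<sigma> {x. p x < e}"
    using openin_seminorm_ball[OF assms(1,3), of 0 e] assms(4) by (simp add: coarser_topology_def)
  ultimately show "\<exists>V. openin \<sigma> V \<and> 0 \<in> V \<and> (\<forall>x\<in>V. p x < e)"
    by (intro exI[of _ "{x. p x < e}"]) (simp add: seminorm_zero[OF assms(1,3)])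
qed

text \<open>The predicate holds for two topologies only, so \<open>sup_topology\<close> is here the
  join that adjoins \<open>p\<close> to \<open>\<sigma>\<close>.\<close>

lemma locally_convex_sup_seminorm:
  assumes "normed_space_over s" "locally_convex_topology s \<sigma>" "seminorm s p"
  shows "locally_convex_topology s (sup_topology (\<lambda>\<rho>. \<rho> = \<sigma> \<or> \<rho> = seminorm_topology p))"
  using assms locally_convex_seminorm_topology[OF assms(1,3)]
  by (intro locally_convex_sup_topology[of _ \<sigma>]) auto

lemma coarser_topology_trans:
  "coarser_topology \<sigma> \<rho> \<Longrightarrow> coarser_topology \<rho> \<pi> \<Longrightarrow> coarser_topology \<sigma> \<pi>"
  by (simp add: coarser_topology_def)

text \<open>Adjoining \<open>p\<close> to the topology \<open>\<gamma>\<close> does not change the convergent sequences.\<close>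

lemma continuous_seminorm_if_sequentially:
  fixes s :: "'k::real_normed_field \<Rightarrow> 'a::real_normed_vector \<Rightarrow> 'a"
  assumes ns: "normed_space_over s" and lc: "locally_convex_topology s \<gamma>"
    and plus: "plus_topology s \<gamma> = \<gamma>" and p: "seminorm s p"
    and seq: "\<And>x :: nat \<Rightarrow> 'a. limitin \<gamma> x 0 sequentially \<Longrightarrow> (\<lambda>n. p (x n)) \<longlonglongrightarrow> 0"
  shows "continuous_seminorm s \<gamma> p"
proof (rule continuous_seminorm_if_coarser[OF ns lc p])
  let ?P = "\<lambda>\<rho>. \<rho> = \<gamma> \<or> \<rho> = seminorm_topology p"
  let ?S = "sup_topology ?P"
  have lcS: "locally_convex_topology s ?S" by (rule locally_convex_sup_seminorm[OF ns lc p])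
  note top = topspace_lc[OF ns lc] topspace_lc[OF ns lcS]
  have "limitin ?S x l sequentially \<longleftrightarrow> limitin \<gamma> x l sequentially" for x :: "nat \<Rightarrow> 'a" and l
  proof
    assume "limitin ?S x l sequentially"
    moreover have "coarser_topology \<gamma> ?S" using coarser_sup_topology[of ?P \<gamma>] by simp
    ultimately show "limitin \<gamma> x l sequentially"
      by (simp add: limitin_def coarser_topology_def top)
  next
    assume L: "limitin \<gamma> x l sequentially"
    have "l \<in> U \<longrightarrow> (\<forall>\<^sub>F n in sequentially. x n \<in> U)" if "openin ?S U" for U
      using that
    proof (induction rule: openin_sup_topology_induct)
      case (Int a b) then show ?case by (auto intro: eventually_conj)
    next
      case (UN K)
      show ?case
      proof
        assume "l \<in> \<Union>K"
        then obtain k where k: "k \<in> K" "l \<in> k" by blast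
        with UN[of k] have "\<forall>\<^sub>F n in sequentially. x n \<in> k" by simp
        then show "\<forall>\<^sub>F n in sequentially. x n \<in> \<Union>K"
          by (rule eventually_mono) (use k in blast)
      qed
    next
      case (Basis \<sigma> a)
      show ?case
      proof
        assume l: "l \<in> a"
        from Basis(1) show "\<forall>\<^sub>F n in sequentially. x n \<in> a"
        proof
          assume "\<sigma> = \<gamma>" then show ?thesis using L l Basis(2) by (simp add: limitin_def)
        next
          assume "\<sigma> = seminorm_topology p"
          then obtain e where e: "0 < e" "\<And>y. p (y - l) < e \<Longrightarrow> y \<in> a"
            using Basis(2) l by (auto simp: openin_seminorm_topology)
          have "(\<lambda>n. p (x n - l)) \<longlonglongrightarrow> 0"
            using L by (intro seq) (simp add: limitin_diff_zero[OF ns lc])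
          then have "\<forall>\<^sub>F n in sequentially. p (x n - l) < e" using e(1) by (rule order_tendstoD)
          then show ?thesis by (rule eventually_mono) (rule e(2))
        qed
      qed
    qed simp
    then show "limitin ?S x l sequentially" by (simp add: limitin_def top)
  qed
  then have "coarser_topology ?S \<gamma>"
    using is_strongest_plus_topology[OF lc] lcS plus by (simp add: is_strongest_topology_def)
  with coarser_sup_topology[of ?P "seminorm_topology p"]
  show "coarser_topology (seminorm_topology p) \<gamma>" by (blast intro: coarser_topology_trans)
qed

section \<open>The mixed topology, its continuous seminorms and its bounded sets\<close>

context
  fixes s :: "'k::real_normed_field \<Rightarrow> 'a::real_normed_vector \<Rightarrow> 'a" and \<tau> \<gamma> :: "'a topology"
  assumes ns: "normed_space_over s" and lc_tau: "locally_convex_topology s \<tau>"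
    and gamma: "\<gamma> = mixed_topology s \<tau>"
begin

lemma lc_mixed: "locally_convex_topology s \<gamma>"
  and subtopology_mixed: "bounded B \<Longrightarrow> subtopology \<gamma> B = subtopology \<tau> B"
  using is_strongest_mixed_topology[OF lc_tau] by (auto simp: is_strongest_topology_def gamma)

lemma mixed_strongest:
  assumes "locally_convex_topology s \<sigma>" "\<And>B. bounded B \<Longrightarrow> subtopology \<sigma> B = subtopology \<tau> B"
  shows "coarser_topology \<sigma> \<gamma>"
  using is_strongest_mixed_topology[OF lc_tau] assms by (auto simp: is_strongest_topology_def gamma)

lemma tau_coarser_mixed: "coarser_topology \<tau> \<gamma>"
  by (rule mixed_strongest[OF lc_tau refl])

lemma openin_mixed_Int_bounded:
  assumes "openin \<gamma> U" "bounded B"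
  obtains V where "openin \<tau> V" "U \<inter> B = V \<inter> B"
proof -
  have "openin (subtopology \<tau> B) (U \<inter> B)"
    using assms(1) by (auto simp: openin_subtopology simp flip: subtopology_mixed[OF assms(2)])
  then show thesis using that by (auto simp: openin_subtopology)
qed

text \<open>Norm openness is local and unit balls are bounded, so near each point a
  \<open>\<gamma>\<close>-open set may be replaced by a \<open>\<tau>\<close>-open one.\<close>

lemma mixed_coarser_euclidean:
  assumes "coarser_topology \<tau> euclidean"
  shows "coarser_topology \<gamma> euclidean"
  unfolding coarser_topology_def
proof (intro allI impI)
  fix U assume U: "openin \<gamma> U"
  have "\<exists>W. open W \<and> x \<in> W \<and> W \<subseteq> U" if x: "x \<in> U" for x
  proof -
    obtain V where V: "openin \<tau> V" "U \<inter> ball x 1 = V \<inter> ball x 1"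
      using openin_mixed_Int_bounded[OF U, of "ball x 1"] by auto
    have "open (V \<inter> ball x 1)" using V(1) assms by (simp add: coarser_topology_def open_Int)
    moreover have "x \<in> ball x 1" by simp
    then have "x \<in> V \<inter> ball x 1" "V \<inter> ball x 1 \<subseteq> U" using V(2) x by blast+
    ultimately show ?thesis by blast
  qed
  then have "open U" by (subst open_subopen) blast
  then show "openin euclidean U" by simp
qed

text \<open>Convergence depends only on the trace on a set containing the sequence and its limit.
  Here that set is bounded, so both topologies induce the same trace.\<close>

lemma limitin_mixedI:
  assumes "limitin \<tau> x l sequentially" "bounded (range x)"
  shows "limitin \<gamma> x l sequentially"
proof -
  let ?B = "insert l (range x)"
  have "limitin (subtopology \<tau> ?B) x l sequentially"
    using assms(1) by (simp add: limitin_subtopology)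
  moreover have "bounded ?B" using assms(2) by simp
  ultimately have "limitin (subtopology \<gamma> ?B) x l sequentially" by (simp add: subtopology_mixed)
  then show ?thesis by (simp add: limitin_subtopology)
qed

lemma limitin_tau_if_mixed: "limitin \<gamma> x l F \<Longrightarrow> limitin \<tau> x l F"
  using tau_coarser_mixed
  by (simp add: limitin_def coarser_topology_def topspace_lc[OF ns lc_tau] topspace_lc[OF ns lc_mixed])

text \<open>Adjoining \<open>p\<close> to \<open>\<gamma>\<close> does not change the traces on bounded sets.\<close>

lemma continuous_seminorm_mixedI:
  assumes p: "seminorm s p"
    and small: "\<And>B e. bounded B \<Longrightarrow> 0 < e \<Longrightarrow> \<exists>V. openin \<tau> V \<and> 0 \<in> V \<and> (\<forall>x\<in>V \<inter> B. p x < e)"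
  shows "continuous_seminorm s \<gamma> p"
proof (rule continuous_seminorm_if_coarser[OF ns lc_mixed p])
  let ?P = "\<lambda>\<rho>. \<rho> = \<gamma> \<or> \<rho> = seminorm_topology p"
  let ?S = "sup_topology ?P"
  have "subtopology ?S B = subtopology \<tau> B" if B: "bounded B" for B
  proof -
    have fine: "openin ?S U" if "openin \<tau> U" for U
      using that tau_coarser_mixed coarser_sup_topology[of ?P \<gamma>] by (simp add: coarser_topology_def)
    \<comment> \<open>Traces commute with finite intersections and with unions, so only the two
      generating topologies need a real argument.\<close>
    have trace: "openin (subtopology \<tau> B) (U \<inter> B)" if "openin ?S U" for U
      using that
    proof (induction rule: openin_sup_topology_induct)
      case (Int a b)
      then have "openin (subtopology \<tau> B) ((a \<inter> B) \<inter> (b \<inter> B))" by blast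
      then show ?case by (simp add: Int_ac)
    next
      case (UN K)
      then have "openin (subtopology \<tau> B) (\<Union>((\<lambda>k. k \<inter> B) ` K))" by (intro openin_Union) blast
      moreover have "\<Union>((\<lambda>k. k \<inter> B) ` K) = \<Union>K \<inter> B" by blast
      ultimately show ?case by simp
    next
      case (Basis \<sigma> a)
      from Basis(1) show ?case
      proof
        assume "\<sigma> = \<gamma>"
        with Basis(2) have "openin \<gamma> a" by simp
        from openin_mixed_Int_bounded[OF this B] obtain V where "openin \<tau> V" "a \<inter> B = V \<inter> B" .
        then show ?thesis unfolding openin_subtopology by blast
      next
        assume \<sigma>: "\<sigma> = seminorm_topology p"
        show ?thesis
        proof (subst openin_subopen, intro ballI)
          fix x assume x: "x \<in> a \<inter> B"
          then obtain e where e: "0 < e" "\<And>y. p (y - x) < e \<Longrightarrow> y \<in> a"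
            using Basis(2) \<sigma> by (auto simp: openin_seminorm_topology)
          \<comment> \<open>The hypothesis \<open>small\<close> speaks about neighbourhoods of 0;
            for the point \<open>x\<close> it is applied to the bounded set of differences.\<close>
          have "bounded ((\<lambda>y. y - x) ` B)" using B by (simp add: bounded_translation_minus)
          from small[OF this e(1)] obtain V where V: "openin \<tau> V" "0 \<in> V"
            "\<And>y. y - x \<in> V \<Longrightarrow> y \<in> B \<Longrightarrow> p (y - x) < e" by auto
          have "openin (subtopology \<tau> B) ({y. y - x \<in> V} \<inter> B)"
            using openin_translate_diff[OF ns lc_tau V(1), of x] by (auto simp: openin_subtopology)
          then show "\<exists>W. openin (subtopology \<tau> B) W \<and> x \<in> W \<and> W \<subseteq> a \<inter> B"
            using V(2,3) e(2) x by (intro exI[of _ "{y. y - x \<in> V} \<inter> B"]) auto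
        qed
      qed
    qed simp
    show ?thesis
    proof (rule topology_eq[THEN iffD2], intro allI iffI)
      fix W assume "openin (subtopology ?S B) W"
      then obtain U where "openin ?S U" "W = U \<inter> B" unfolding openin_subtopology by blast
      then show "openin (subtopology \<tau> B) W" using trace by simp
    next
      fix W assume "openin (subtopology \<tau> B) W"
      then obtain U where "openin \<tau> U" "W = U \<inter> B" unfolding openin_subtopology by blast
      then show "openin (subtopology ?S B) W" using fine unfolding openin_subtopology by blast
    qed
  qed
  with locally_convex_sup_seminorm[OF ns lc_mixed p] have "coarser_topology ?S \<gamma>"
    by (rule mixed_strongest)
  with coarser_sup_topology[of ?P "seminorm_topology p"]
  show "coarser_topology (seminorm_topology p) \<gamma>" by (blast intro: coarser_topology_trans)
qed

text \<open>The zero functional makes the dual ball nonempty and \<open>norm x\<close> bounds the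
  values, so any \<open>r\<close> below the supremum is exceeded by some functional.\<close>

lemma norming_witness:
  assumes norming: "norming_dual s \<tau>" and "r < norm x"
  obtains f where "f \<in> dual_unit_ball s \<tau>" "r < norm (f x)"
proof -
  have "vector_space ((*) :: 'k \<Rightarrow> 'k \<Rightarrow> 'k)"
    by unfold_locales (simp_all add: algebra_simps)
  then have "Vector_Spaces.linear s (*) (\<lambda>_. 0 :: 'k)"
    using vector_space_scalars[OF ns] by (simp add: Vector_Spaces.linear_iff)
  then have "(\<lambda>_. 0 :: 'k) \<in> dual_unit_ball s \<tau>"
    by (simp add: dual_unit_ball_def continuous_dual_def onorm_zero)
  then have ne: "dual_unit_ball s \<tau> \<noteq> {}" by blast
  have "bdd_above ((\<lambda>f. norm (f x)) ` dual_unit_ball s \<tau>)"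
  proof (rule bdd_aboveI2)
    fix f assume f: "f \<in> dual_unit_ball s \<tau>"
    then have "norm (f x) \<le> onorm f * norm x" by (intro onorm) (simp add: dual_unit_ball_def)
    also have "\<dots> \<le> 1 * norm x" using f by (intro mult_right_mono) (simp_all add: dual_unit_ball_def)
    finally show "norm (f x) \<le> norm x" by simp
  qed
  from less_cSUP_iff[OF ne this, of r]
  have "r < (SUP f\<in>dual_unit_ball s \<tau>. norm (f x)) \<longleftrightarrow> (\<exists>f\<in>dual_unit_ball s \<tau>. r < norm (f x))" .
  moreover have "norm x = (SUP f\<in>dual_unit_ball s \<tau>. norm (f x))"
    using norming by (simp only: norming_dual_def)
  ultimately show thesis using that \<open>r < norm x\<close> by auto
qed

text \<open>On an unbounded set \<open>S\<close> the seminorm \<open>sup\<^sub>k |f\<^sub>k x| / (k + 1)\<close> is unbounded for suitable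
  \<open>f\<^sub>k\<close> in the dual unit ball, and the decay of the weights makes it \<open>\<tau>\<close>-continuous on bounded sets.\<close>

lemma bounded_if_continuous_seminorms_bounded:
  assumes norming: "norming_dual s \<tau>"
    and bdd: "\<And>p. continuous_seminorm s \<gamma> p \<Longrightarrow> bdd_above (p ` S)"
  shows "bounded S"
proof (rule ccontr)
  assume "\<not> bounded S"
  \<comment> \<open>The square leaves a value above \<open>real k + 1\<close> after division by the
    weight \<open>real k + 1\<close>.\<close>
  then have "\<exists>y\<in>S. (real k + 1)\<^sup>2 < norm y" for k by (meson bounded_iff linorder_not_le)
  then obtain y where y: "\<And>k. y k \<in> S" "\<And>k. (real k + 1)\<^sup>2 < norm (y k)" by metis
  have "\<exists>f\<in>dual_unit_ball s \<tau>. (real k + 1)\<^sup>2 < norm (f (y k))" for k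
    using norming_witness[OF norming y(2)[of k]] by blast
  then obtain f where f: "\<And>k. f k \<in> dual_unit_ball s \<tau>" "\<And>k. (real k + 1)\<^sup>2 < norm (f k (y k))"
    by metis
  have lin: "Vector_Spaces.linear s (*) (f k)" and cont: "continuous_map \<tau> euclidean (f k)"
    and bl: "bounded_linear (f k)" and on: "onorm (f k) \<le> 1" for k
    using f(1)[of k] by (auto simp: dual_unit_ball_def continuous_dual_def)
  have le: "norm (f k x) \<le> norm x" for k x
    using onorm[OF bl, of k x] on[of k] mult_right_mono[OF on, of "norm x" k] by simp
  define q where "q k x = norm (f k x) / (real k + 1)" for k x
  define p where "p x = (SUP k. q k x)" for x
  have q: "seminorm s (q k)" for k
    using lin[of k]
    by (auto simp: Vector_Spaces.linear_iff seminorm_def q_def norm_mult norm_triangle_ineq divide_right_mono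
        simp flip: add_divide_distrib)
  have q_le: "q k x \<le> norm x / (real k + 1)" for k x
    using le by (simp add: q_def divide_right_mono)
  have bq: "bdd_above (range (\<lambda>k. q k x))" for x
  proof (rule bdd_aboveI2)
    show "q k x \<le> norm x" for k
      using q_le[of k x] by (rule order_trans) (simp add: divide_le_eq mult_left_le field_simps)
  qed
  have "seminorm s p"
    unfolding p_def using seminorm_SUP[OF ns, of UNIV q] q bq by simp
  then have "continuous_seminorm s \<gamma> p"
  proof (rule continuous_seminorm_mixedI)
    fix B :: "'a set" and e :: real assume "bounded B" "0 < e"
    then obtain R where R: "\<And>x. x \<in> B \<Longrightarrow> norm x \<le> R" by (auto simp: bounded_iff)
    \<comment> \<open>On \<open>B\<close> the terms with index at least \<open>K\<close> are at most
      \<open>e / 2\<close> by the weights alone. The finitely many others are controlled by the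
      \<open>\<tau>\<close>-open set \<open>V\<close>.\<close>
    obtain K where K: "2 * R / e < real K" using reals_Archimedean2 by blast
    define V where "V = (\<Inter>k<K. {x. norm (f k x) < e / 2}) \<inter> topspace \<tau>"
    have "openin \<tau> {x. norm (f k x) < e / 2}" for k
      using openin_continuous_map_preimage[OF cont, of "ball 0 (e / 2)" k]
      by (simp add: topspace_lc[OF ns lc_tau])
    then have "openin \<tau> V"
      unfolding V_def by (cases "K = 0") (auto intro!: openin_Int openin_INT)
    moreover have "0 \<in> V"
      using \<open>0 < e\<close> by (simp add: V_def topspace_lc[OF ns lc_tau] linear_0[OF bounded_linear.linear[OF bl]])
    moreover have "p x < e" if x: "x \<in> V" "x \<in> B" for x
    proof -
      \<comment> \<open>The bound is \<open>e / 2\<close> because a strict bound by \<open>e\<close>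
        need not survive the supremum.\<close>
      have "q k x \<le> e / 2" for k
      proof (cases "k < K")
        case True
        then have "norm (f k x) \<le> e / 2" using x(1) by (force simp: V_def)
        then show ?thesis using \<open>0 < e\<close> unfolding q_def
          by (smt (verit) divide_le_eq mult_left_le norm_ge_zero of_nat_0_le_iff mult_le_cancel_left1)
      next
        case False
        then have "2 * R / e < real k + 1" using K by simp
        then have "R / (real k + 1) \<le> e / 2" using \<open>0 < e\<close> by (simp add: field_simps)
        moreover have "norm x / (real k + 1) \<le> R / (real k + 1)"
          using R[OF x(2)] by (simp add: divide_right_mono)
        ultimately show ?thesis using q_le[of k x] by linarith
      qed
      then have "p x \<le> e / 2" unfolding p_def by (intro cSUP_least) auto
      then show ?thesis using \<open>0 < e\<close> by simp
    qed
    ultimately show "\<exists>V. openin \<tau> V \<and> 0 \<in> V \<and> (\<forall>x\<in>V \<inter> B. p x < e)" by blast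
  qed
  from bdd[OF this] obtain C where C: "\<And>x. x \<in> S \<Longrightarrow> p x \<le> C" by (auto simp: bdd_above_def)
  obtain k where k: "C < real k" using reals_Archimedean2 by blast
  have "real k + 1 \<le> q k (y k)"
    using f(2)[of k] by (simp add: q_def field_simps power2_eq_square)
  also have "\<dots> \<le> p (y k)" unfolding p_def by (rule cSUP_upper[OF UNIV_I bq])
  also have "\<dots> \<le> C" by (rule C[OF y(1)])
  finally show False using k by simp
qed

lemma continuous_seminorm_tendsto_zero:
  assumes "continuous_seminorm s \<gamma> p" "limitin \<gamma> x 0 F"
  shows "((\<lambda>n. p (x n)) \<longlongrightarrow> 0) F"
proof -
  have "p 0 = 0" using assms(1) seminorm_zero[OF ns] by (simp add: continuous_seminorm_def)
  moreover have "continuous_map \<gamma> euclideanreal p" using assms(1) by (simp add: continuous_seminorm_def)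
  from continuous_map_limit[OF this assms(2)] have "limitin euclideanreal (p \<circ> x) (p 0) F" .
  ultimately show ?thesis by (simp add: comp_def)
qed

text \<open>Each continuous seminorm converges along \<open>x\<close>, hence is bounded on its
  range, and the norming dual turns this into a norm bound.\<close>

lemma bounded_if_limitin_mixed:
  assumes norming: "norming_dual s \<tau>" and x: "limitin \<gamma> (x :: nat \<Rightarrow> 'a) 0 sequentially"
  shows "bounded (range x)"
proof (rule bounded_if_continuous_seminorms_bounded[OF norming])
  fix p assume "continuous_seminorm s \<gamma> p"
  from continuous_seminorm_tendsto_zero[OF this x]
  have "bounded (range (\<lambda>n. p (x n)))" by (rule convergent_imp_bounded)
  then show "bdd_above (p ` range x)" by (simp add: image_image bounded_imp_bdd_above)
qed

end

section \<open>Semigroups\<close>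

text \<open>Additivity moves the question to 0, where seminorm balls form a neighbourhood base. It
  yields continuity of each \<open>T t\<close> from the domination estimate alone.\<close>

lemma continuous_map_if_seminorms:
  fixes s :: "'k::real_normed_field \<Rightarrow> 'a::real_normed_vector \<Rightarrow> 'a"
  assumes ns: "normed_space_over s" and lc: "locally_convex_topology s \<sigma>"
    and diff: "\<And>x y. f (x - y) = f x - f y"
    and dom: "\<And>p. continuous_seminorm s \<sigma> p \<Longrightarrow> \<exists>q. continuous_seminorm s \<sigma> q \<and> (\<forall>x. p (f x) \<le> q x)"
  shows "continuous_map \<sigma> \<sigma> f"
proof -
  have "openin \<sigma> {x. f x \<in> U}" if U: "openin \<sigma> U" for U
  proof (subst openin_subopen, intro ballI)
    fix x assume "x \<in> {x. f x \<in> U}"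
    then have "openin \<sigma> {z. z + f x \<in> U}" "0 \<in> {z. z + f x \<in> U}"
      using openin_translate[OF ns lc U] by auto
    then obtain p where p: "continuous_seminorm s \<sigma> p" "\<And>z. p z < 1 \<Longrightarrow> z + f x \<in> U"
      using continuous_seminorm_neighbourhood[OF ns lc] by (metis mem_Collect_eq)
    obtain q where q: "continuous_seminorm s \<sigma> q" "\<And>x. p (f x) \<le> q x" using dom[OF p(1)] by blast
    have "f y \<in> U" if "q (y - x) < 1" for y
      using p(2)[of "f y - f x"] q(2)[of "y - x"] that by (simp add: diff)
    moreover have "openin \<sigma> {y. q (y - x) < 1}"
      using openin_translate_diff[OF ns lc openin_continuous_seminorm_ball[OF ns lc q(1)], of x 1] by simp
    moreover have "q 0 = 0" using q(1) seminorm_zero[OF ns] by (simp add: continuous_seminorm_def)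
    ultimately show "\<exists>W. openin \<sigma> W \<and> x \<in> W \<and> W \<subseteq> {x. f x \<in> U}"
      by (intro exI[of _ "{y. q (y - x) < 1}"]) auto
  qed
  then show ?thesis by (simp add: continuous_map_def topspace_lc[OF ns lc])
qed

section \<open>Algebra and norm growth of a semigroup\<close>

context
  fixes s :: "'k::real_normed_field \<Rightarrow> 'a::real_normed_vector \<Rightarrow> 'a"
    and T :: "real \<Rightarrow> 'a \<Rightarrow> 'a"
  assumes ns: "normed_space_over s" and semigroup: "operator_semigroup s T"
begin

lemma semigroup_compose: "0 \<le> t \<Longrightarrow> 0 \<le> u \<Longrightarrow> T t (T u x) = T (t + u) x"
  using semigroup unfolding operator_semigroup_def by (metis comp_apply)

lemma semigroup_add: "0 \<le> t \<Longrightarrow> T t (x + y) = T t x + T t y"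
  and semigroup_scale: "0 \<le> t \<Longrightarrow> T t (s c x) = s c (T t x)"
  using semigroup
  by (auto simp: operator_semigroup_def Vector_Spaces.linear_iff)

lemma semigroup_scaleR: "0 \<le> t \<Longrightarrow> T t (r *\<^sub>R x) = r *\<^sub>R T t x"
  using semigroup_scale[of t "of_real r" x] by (simp add: scale_of_real[OF ns])

lemma semigroup_diff: "0 \<le> t \<Longrightarrow> T t (x - y) = T t x - T t y"
  using semigroup_add[of t "x - y" y] by simp

lemma seminorm_semigroup:
  assumes "0 \<le> t" "seminorm s p" shows "seminorm s (\<lambda>x. p (T t x))"
  using assms by (simp add: seminorm_def semigroup_add semigroup_scale)

lemma seminorm_norm: "seminorm s norm"
  by (simp add: seminorm_def norm_scale[OF ns] norm_triangle_ineq)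

text \<open>The seminorm \<open>norm (T t x)\<close> has a norm open unit ball. Bounded linearity is
  what lets a bound on \<open>onorm (T t)\<close> control \<open>norm (T t x)\<close>.\<close>

lemma bounded_linear_semigroup:
  assumes t: "0 \<le> t" and "continuous_on UNIV (T t)" shows "bounded_linear (T t)"
proof -
  have "open {x. norm (T t x) < 1}"
    using assms(2) by (intro open_Collect_less continuous_on_norm) (auto intro: continuous_intros)
  moreover have "T t 0 = 0" using semigroup_scaleR[OF t, of 0 0] by simp
  ultimately obtain C where "\<And>x. norm (T t x) \<le> C * norm x"
    using seminorm_le_norm[OF ns seminorm_semigroup[OF t seminorm_norm], of "{x. norm (T t x) < 1}"]
    by auto
  then show ?thesis
    by (intro bounded_linear_intro[of _ C]) (simp_all add: semigroup_add semigroup_scaleR t mult.commute)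
qed

text \<open>Split \<open>t\<close> into its integer part \<open>n\<close> and a remainder in
  \<open>{0..1}\<close>: each unit step costs a factor \<open>M\<close>, the remainder one more. As
  \<open>1 \<le> M\<close>, \<open>ln M\<close> is nonnegative and
  \<open>M ^ n \<le> exp (ln M * t)\<close>.\<close>

lemma norm_semigroup_exponential:
  assumes M: "1 \<le> M" and le: "\<And>u x. u \<in> {0..1} \<Longrightarrow> norm (T u x) \<le> M * norm x" and t: "0 \<le> t"
  shows "norm (T t x) \<le> M * exp (ln M * t) * norm x"
proof -
  have pow: "norm (T (real n + u) x) \<le> M * M ^ n * norm x" if u: "u \<in> {0..1}" for n u
  proof (induction n)
    case 0 then show ?case using le[OF u] by simp
  next
    case (Suc n)
    have "norm (T (real (Suc n) + u) x) = norm (T 1 (T (real n + u) x))"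
      using u by (simp add: semigroup_compose add.assoc)
    also have "\<dots> \<le> M * norm (T (real n + u) x)" by (rule le) simp
    also have "\<dots> \<le> M * (M * M ^ n * norm x)" using Suc M by (intro mult_left_mono) auto
    finally show ?case by (simp add: mult_ac)
  qed
  define n where "n = nat \<lfloor>t\<rfloor>"
  have n: "real n \<le> t" "t - real n \<in> {0..1}" using t by (auto simp: n_def) linarith+
  have "M ^ n = exp (ln M * real n)" using M by (simp add: exp_of_nat2_mult)
  also have "\<dots> \<le> exp (ln M * t)" using n M by (simp add: mult_left_mono)
  finally have "M * M ^ n * norm x \<le> M * exp (ln M * t) * norm x"
    using M by (intro mult_right_mono mult_left_mono) auto
  with pow[OF n(2), of n] show ?thesis by simp
qed

section \<open>The two implications between bi-continuity and the SCLE property\<close>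

context
  fixes \<tau> \<gamma> :: "'a topology"
  assumes lc_tau: "locally_convex_topology s \<tau>" and norming: "norming_dual s \<tau>"
    and gamma: "\<gamma> = mixed_topology s \<tau>"
begin

lemma SCLE_if_bicontinuous:
  assumes plus: "plus_topology s \<gamma> = \<gamma>" and bi: "bicontinuous_semigroup s \<tau> T"
  shows "SCLE_semigroup s \<gamma> T"
proof -
  note lc = lc_mixed[OF ns lc_tau gamma]
  obtain M \<omega> where M: "1 \<le> M" "\<And>t. 0 \<le> t \<Longrightarrow> onorm (T t) \<le> M * exp (\<omega> * t)"
    using bi by (auto simp: bicontinuous_semigroup_def)
  \<comment> \<open>The absolute value makes the bound increasing in time, so one constant serves
    all of \<open>{0..t0}\<close> whatever the sign of \<open>\<omega>\<close>.\<close>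
  define K where "K t0 = M * exp (\<bar>\<omega>\<bar> * t0)" for t0
  have K0: "0 \<le> K t0" for t0 using M(1) by (simp add: K_def)
  have K: "norm (T t x) \<le> K t0 * norm x" if "t \<in> {0..t0}" for t t0 x
  proof -
    have t: "0 \<le> t" "t \<le> t0" using that by auto
    have "norm (T t x) \<le> onorm (T t) * norm x"
      using bi t by (intro onorm bounded_linear_semigroup) (auto simp: bicontinuous_semigroup_def)
    moreover have "\<omega> * t \<le> \<bar>\<omega>\<bar> * t0" using t by (intro mult_mono) auto
    then have "onorm (T t) \<le> K t0"
      using M(1) by (intro order_trans[OF M(2)[OF t(1)]]) (simp add: K_def)
    ultimately show ?thesis by (meson mult_right_mono norm_ge_zero order_trans)
  qed
  have orbit: "continuous_map (top_of_set {0..}) \<gamma> (\<lambda>t. T t x)" for x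
  proof -
    have "openin (top_of_set {0..}) {t \<in> {0..}. T t x \<in> U}" if U: "openin \<gamma> U" for U
    proof (subst openin_subopen, intro ballI)
      fix t assume t: "t \<in> {t \<in> {0..}. T t x \<in> U}"
      \<comment> \<open>Up to time \<open>t + 1\<close> the orbit stays in this ball, on which
        \<open>U\<close> has the trace of a \<open>\<tau>\<close>-open set; the extra 1 leaves room
        around \<open>t\<close>.\<close>
      define B where "B = cball (0::'a) (K (t + 1) * norm x)"
      obtain V where V: "openin \<tau> V" "U \<inter> B = V \<inter> B"
        using openin_mixed_Int_bounded[OF ns lc_tau gamma U, of B] by (auto simp: B_def)
      have B: "T u x \<in> B" if "0 \<le> u" "u < t + 1" for u
        using K[of u "t + 1" x] that by (simp add: B_def)
      have "continuous_map (top_of_set {0..}) \<tau> (\<lambda>t. T t x)"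
        using bi by (simp add: bicontinuous_semigroup_def)
      from openin_continuous_map_preimage[OF this V(1)]
      have "openin (top_of_set {0..}) {u \<in> {0..}. T u x \<in> V}" by simp
      then have "openin (top_of_set {0..}) ({u \<in> {0..}. T u x \<in> V} \<inter> ({0..} \<inter> {..<t + 1}))"
        by (intro openin_Int openin_open_Int open_lessThan)
      moreover have "T u x \<in> U \<longleftrightarrow> T u x \<in> V" if "0 \<le> u" "u < t + 1" for u
        using V(2) B[OF that] by blast
      ultimately show "\<exists>W. openin (top_of_set {0..}) W \<and> t \<in> W \<and> W \<subseteq> {t \<in> {0..}. T t x \<in> U}"
        using t by (intro exI[of _ "{u \<in> {0..}. T u x \<in> V} \<inter> ({0..} \<inter> {..<t + 1})"]) auto
    qed
    then show ?thesis by (simp add: continuous_map_def topspace_lc[OF ns lc])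
  qed
  have dom: "\<exists>q. continuous_seminorm s \<gamma> q \<and> (\<forall>x. \<forall>u\<in>{0..t}. p (T u x) \<le> q x)"
    if t: "0 \<le> t" and p: "continuous_seminorm s \<gamma> p" for t p
  proof (intro exI conjI allI ballI)
    define q where "q x = (SUP u\<in>{0..t}. p (T u x))" for x
    have sp: "seminorm s p" using p by (simp add: continuous_seminorm_def)
    \<comment> \<open>A continuous function is bounded on the compact interval, so the supremum
      defining \<open>q\<close> is finite.\<close>
    have bdd: "bdd_above ((\<lambda>u. p (T u x)) ` {0..t})" for x
    proof -
      have "continuous_map (top_of_set {0..}) euclideanreal (p \<circ> (\<lambda>u. T u x))"
        using orbit p unfolding continuous_seminorm_def by (blast intro: continuous_map_compose)
      then have "continuous_on {0..} (\<lambda>u. p (T u x))" by (simp add: comp_def)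
      then have "continuous_on {0..t} (\<lambda>u. p (T u x))" by (rule continuous_on_subset) auto
      then show ?thesis
        by (intro bounded_imp_bdd_above compact_imp_bounded compact_continuous_image) auto
    qed
    show "p (T u x) \<le> q x" if "u \<in> {0..t}" for u x
      unfolding q_def by (rule cSUP_upper[OF that bdd])
    have sq: "seminorm s q"
      unfolding q_def using t bdd by (intro seminorm_SUP[OF ns] seminorm_semigroup[OF _ sp]) auto
    show "continuous_seminorm s \<gamma> q"
    proof (rule continuous_seminorm_if_sequentially[OF ns lc plus sq])
      fix x :: "nat \<Rightarrow> 'a" assume x: "limitin \<gamma> x 0 sequentially"
      have bx: "bounded (range x)" by (rule bounded_if_limitin_mixed[OF ns lc_tau gamma norming x])
      then obtain R where R: "\<And>n. norm (x n) \<le> R" by (auto simp: bounded_iff)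
      \<comment> \<open>All vectors \<open>T u (x n)\<close> with \<open>u \<in> {0..t}\<close> lie
        in this ball. There the \<open>\<gamma>\<close>-open ball of \<open>p\<close> has the trace
        of a \<open>\<tau>\<close>-open \<open>V\<close>, so local bi-continuity applies.\<close>
      define B where "B = cball (0::'a) (K t * R)"
      have B: "T u (x n) \<in> B" if "u \<in> {0..t}" for u n
        using K[OF that, of "x n"] mult_left_mono[OF R[of n] K0[of t]] by (simp add: B_def)
      have R0: "0 \<le> R" using R norm_ge_zero order_trans by blast
      show "(\<lambda>n. q (x n)) \<longlonglongrightarrow> 0"
      proof (rule LIMSEQ_I)
        fix e :: real assume e: "0 < e"
        have "bounded B" by (simp add: B_def)
        from openin_mixed_Int_bounded[OF ns lc_tau gamma openin_continuous_seminorm_ball[OF ns lc p] this]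
        obtain V where V: "openin \<tau> V" "{x. p x < e / 2} \<inter> B = V \<inter> B" .
        have "0 \<in> B" using R0 K0 by (simp add: B_def)
        moreover have "p 0 < e / 2" using e by (simp add: seminorm_zero[OF ns sp])
        ultimately have "0 \<in> V" using V(2) by blast
        moreover have "limitin \<tau> x 0 sequentially" by (rule limitin_tau_if_mixed[OF ns lc_tau gamma x])
        ultimately obtain N where N: "\<And>n u. N \<le> n \<Longrightarrow> u \<in> {0..t} \<Longrightarrow> T u (x n - 0) \<in> V"
          using bi t bx V(1) unfolding bicontinuous_semigroup_def by meson
        have "norm (q (x n) - 0) < e" if n: "N \<le> n" for n
        proof -
          have "p (T u (x n)) \<le> e / 2" if "u \<in> {0..t}" for u
          proof -
            have "T u (x n) \<in> V \<inter> B" using N[OF n that] B[OF that] by simp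
            then have "T u (x n) \<in> {x. p x < e / 2}" using V(2) by blast
            then show ?thesis by simp
          qed
          then have "q (x n) \<le> e / 2" unfolding q_def using t by (intro cSUP_least) auto
          then show ?thesis using e seminorm_nonneg[OF ns sq, of "x n"] by simp
        qed
        then show "\<exists>N. \<forall>n\<ge>N. norm (q (x n) - 0) < e" by blast
      qed
    qed
  qed
  have "continuous_map \<gamma> \<gamma> (T t)" if t: "0 \<le> t" for t
  proof (rule continuous_map_if_seminorms[OF ns lc semigroup_diff[OF t]])
    fix p assume "continuous_seminorm s \<gamma> p"
    from dom[OF t this] show "\<exists>q. continuous_seminorm s \<gamma> q \<and> (\<forall>x. p (T t x) \<le> q x)" using t by auto
  qed
  with semigroup orbit dom show ?thesis by (simp add: SCLE_semigroup_def)
qed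

lemma bicontinuous_if_SCLE:
  assumes coarser: "coarser_topology \<tau> euclidean" and scle: "SCLE_semigroup s \<gamma> T"
  shows "bicontinuous_semigroup s \<tau> T"
proof -
  note lc = lc_mixed[OF ns lc_tau gamma]
  have dom: "\<exists>q. continuous_seminorm s \<gamma> q \<and> (\<forall>x. \<forall>u\<in>{0..t}. p (T u x) \<le> q x)"
    if "0 \<le> t" "continuous_seminorm s \<gamma> p" for t p
    using scle that by (simp add: SCLE_semigroup_def)
  have tau_gamma: "openin \<gamma> U" if "openin \<tau> U" for U
    using tau_coarser_mixed[OF ns lc_tau gamma] that by (simp add: coarser_topology_def)
  define S where "S = (\<lambda>(u, x). T u x) ` ({0..1} \<times> cball 0 1)"
  have "bounded S"
  proof (rule bounded_if_continuous_seminorms_bounded[OF ns lc_tau gamma norming])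
    fix p assume "continuous_seminorm s \<gamma> p"
    from dom[OF _ this, of 1] obtain q where q: "continuous_seminorm s \<gamma> q"
      "\<And>u x. u \<in> {0..1} \<Longrightarrow> p (T u x) \<le> q x" by auto
    have sq: "seminorm s q" using q(1) by (simp add: continuous_seminorm_def)
    \<comment> \<open>As \<open>\<gamma>\<close> is coarser than the norm topology, \<open>q\<close>
      is dominated by a multiple of the norm and hence bounded on the unit ball.\<close>
    have "open {x. q x < 1}"
      using mixed_coarser_euclidean[OF ns lc_tau gamma coarser] openin_continuous_seminorm_ball[OF ns lc q(1)]
      by (simp add: coarser_topology_def)
    then obtain C where C: "0 < C" "\<And>x. q x \<le> C * norm x"
      using seminorm_le_norm[OF ns sq, of "{x. q x < 1}"] seminorm_zero[OF ns sq] by auto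
    have "p (T u x) \<le> C" if "u \<in> {0..1}" "norm x \<le> 1" for u x
      using q(2)[OF that(1), of x] C(2)[of x] mult_left_mono[OF that(2) less_imp_le[OF C(1)]] by simp
    then show "bdd_above (p ` S)" by (intro bdd_aboveI[of _ C]) (auto simp: S_def)
  qed
  then obtain R where R: "\<And>u x. u \<in> {0..1} \<Longrightarrow> norm x \<le> 1 \<Longrightarrow> norm (T u x) \<le> R"
    unfolding bounded_iff S_def by fastforce
  \<comment> \<open>The maximum with 1 meets the requirement \<open>1 \<le> M\<close> in both the
    definition and the exponential estimate.\<close>
  define M where "M = max 1 R"
  have M: "1 \<le> M" by (simp add: M_def)
  have unit: "norm (T u x) \<le> M * norm x" if u: "u \<in> {0..1}" for u x
  proof (cases "x = 0")
    case True then show ?thesis using semigroup_scaleR[of u 0 0] u by simp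
  next
    case False
    have "norm (T u ((1 / norm x) *\<^sub>R x)) \<le> M"
      using R[OF u, of "(1 / norm x) *\<^sub>R x"] False by (simp add: M_def)
    then show ?thesis using u False by (simp add: semigroup_scaleR field_simps)
  qed
  have exp_bound: "norm (T t x) \<le> M * exp (ln M * t) * norm x" if "0 \<le> t" for t x
    using M unit that by (rule norm_semigroup_exponential)
  have "onorm (T t) \<le> M * exp (ln M * t)" if "0 \<le> t" for t
    using M exp_bound[OF that] by (intro onorm_bound) auto
  then have "\<exists>M \<omega>. M \<ge> 1 \<and> (\<forall>t\<ge>0. onorm (T t) \<le> M * exp (\<omega> * t))" using M by blast
  moreover have "continuous_on UNIV (T t)" if t: "0 \<le> t" for t
  proof -
    have "bounded_linear (T t)"
      using exp_bound[OF t]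
      by (intro bounded_linear_intro[of _ "M * exp (ln M * t)"])
        (simp_all add: semigroup_add semigroup_scaleR t mult_ac)
    then show ?thesis by (rule bounded_linear.continuous_on[OF _ continuous_on_id])
  qed
  moreover have "continuous_map (top_of_set {0..}) \<tau> (\<lambda>t. T t x)" for x
  proof -
    have "continuous_map (top_of_set {0..}) \<gamma> (\<lambda>t. T t x)" using scle by (simp add: SCLE_semigroup_def)
    then show ?thesis
      using tau_gamma by (simp add: continuous_map_def topspace_lc[OF ns lc] topspace_lc[OF ns lc_tau])
  qed
  moreover have "\<exists>N. \<forall>n\<ge>N. \<forall>t\<in>{0..t0}. T t (x n - l) \<in> U"
    if t0: "0 \<le> t0" and x: "bounded (range x)" "limitin \<tau> x l sequentially" and U: "openin \<tau> U" "0 \<in> U"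
    for t0 and x :: "nat \<Rightarrow> 'a" and l U
  proof -
    obtain p where p: "continuous_seminorm s \<gamma> p" "\<And>x. p x < 1 \<Longrightarrow> x \<in> U"
      using continuous_seminorm_neighbourhood[OF ns lc tau_gamma[OF U(1)] U(2)] by metis
    obtain q where q: "continuous_seminorm s \<gamma> q" "\<And>u x. u \<in> {0..t0} \<Longrightarrow> p (T u x) \<le> q x"
      using dom[OF t0 p(1)] by blast
    \<comment> \<open>Norm boundedness of the sequence upgrades its
      \<open>\<tau>\<close>-convergence to \<open>\<gamma>\<close>-convergence, so that
      \<open>q\<close> tends to 0 along the differences.\<close>
    have "limitin \<gamma> (\<lambda>n. x n - l) 0 sequentially"
      using limitin_mixedI[OF ns lc_tau gamma x(2,1)] by (simp add: limitin_diff_zero[OF ns lc])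
    from continuous_seminorm_tendsto_zero[OF ns lc_tau gamma q(1) this]
    have "\<forall>\<^sub>F n in sequentially. q (x n - l) < 1" by (rule order_tendstoD) simp
    then obtain N where "\<And>n. N \<le> n \<Longrightarrow> q (x n - l) < 1" by (auto simp: eventually_sequentially)
    then show ?thesis using p(2) q(2) by (meson le_less_trans)
  qed
  ultimately show ?thesis
    using semigroup unfolding bicontinuous_semigroup_def by blast
qed

end

end

theorem theorem7p4:
  fixes s :: "'k::real_normed_field \<Rightarrow> 'a::banach \<Rightarrow> 'a"
    and \<tau> \<gamma> :: "'a topology"
    and T :: "real \<Rightarrow> 'a \<Rightarrow> 'a"
  assumes "normed_space_over s"
    and "locally_convex_topology s \<tau>"
    and "coarser_topology \<tau> euclidean"
    and "seq_complete_on_bounded \<tau>"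
    and "norming_dual s \<tau>"
    and "\<gamma> = mixed_topology s \<tau>"
    and "plus_topology s \<gamma> = \<gamma>"
    and "operator_semigroup s T"
  shows "bicontinuous_semigroup s \<tau> T \<longleftrightarrow> SCLE_semigroup s \<gamma> T"
  using SCLE_if_bicontinuous[OF assms(1,8,2,5,6,7)] bicontinuous_if_SCLE[OF assms(1,8,2,5,6,3)] by blast

end
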